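(* Let $q$ be a power of an odd prime. For any integer $n \ge 1$ and any $n$ pairwise distinct elements $a_1,\ldots,a_n \in \mathbb{F}_q$, we have $$\left| L_q(a_1,\ldots,a_n) - 2^{-n} q \right| < \frac{2}{3}\, n\, q^{1/2},$$ and if moreover $n < 2q^{1/2}$, then the factor $2/3$ can be replaced by $1/2$, that is, $$\left| L_q(a_1,\ldots,a_n) - 2^{-n} q \right| < \frac{1}{2}\, n\, q^{1/2}.$$
   Context: $\mathbb{F}_q$ is the finite field of $q$ elements. For polynomials $f_1,\ldots,f_n \in \mathbb{F}_q[X]$, $\mathcal{G}(f_1,\ldots,f_n)$ is the directed graph with nodes labelled by the elements of $\mathbb{F}_q$ and with an edge from $u$ to $v$ ($u,v\in\mathbb{F}_q$) if and only if $f_i(u)=v$ for some $i=1,\ldots,n$. A leaf is a vertex of in-degree $0$. For pairwise distinct $a_1,\ldots,a_n\in\mathbb{F}_q$, $L_q(a_1,\ldots,a_n)$ denotes the number of leaves in $\mathcal{G}(X^2+a_1,\ldots,X^2+a_n)$. *)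

theory Defs
  imports
    Complex_Main
    "HOL-Library.Cardinality"
    "HOL-Computational_Algebra.Polynomial"
    "HOL-Computational_Algebra.Primes"
    "Graph_Theory.Pair_Digraph"
begin

text \<open>
  The edges form a set of ordered pairs, so several polynomials sending \<open>u\<close> to \<open>v\<close> contribute
  a single edge; loops are allowed. All points of the field type are vertices.
\<close>

definition functional_graph :: "nat \<Rightarrow> (nat \<Rightarrow> 'a::comm_semiring_0 poly) \<Rightarrow> 'a pair_pre_digraph"
  where "functional_graph n f =
    \<lparr> pverts = UNIV, parcs = {(u, v). \<exists>i\<in>{1..n}. poly (f i) u = v} \<rparr>"

text \<open>
  \<^const>\<open>in_degree\<close> is a \<^const>\<open>card\<close>, so it is also \<open>0\<close> at a vertex with infinitely many incoming
  arcs; this cannot happen over the finite fields to which the notion is applied.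
\<close>

definition leaves :: "('a, 'b) pre_digraph \<Rightarrow> 'a set"
  where "leaves G = {v \<in> verts G. in_degree G v = 0}"

definition num_leaves :: "nat \<Rightarrow> (nat \<Rightarrow> 'a::{field,finite}) \<Rightarrow> nat"
  where "num_leaves n a =
    card (leaves (with_proj (functional_graph n (\<lambda>i. monom 1 2 + [:a i:]))))"

end

theory Submission
  imports
    "HOL-Algebra.Algebraic_Closure_Type"
    "HOL-Analysis.Kronecker_Approximation_Theorem"
    "HOL-Number_Theory.Residues"
    Defs
begin

text \<open>
  A vertex \<open>v\<close> is a leaf iff \<open>v - a\<close> is a nonsquare for every \<open>a\<close> in \<open>A = {a\<^sub>1, \<dots>, a\<^sub>n}\<close>. With the quadratic
  character, \<open>2^n\<close> times the indicator function of this condition is \<open>\<Prod>a\<in>A. 1 - quad_char (v - a)\<close>,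
  except at the \<open>n\<close> points of \<open>A\<close>. Expanding the product leads to the sums
  \<open>S(T) = \<Sum>v. \<Prod>a\<in>T. quad_char (v - a)\<close> over the subsets \<open>T\<close> of \<open>A\<close>. The empty set gives the main term \<open>q\<close>,
  and the others are controlled by Weil's bound \<open>\<bar>S(T)\<bar> \<le> (card T - 1) sqrt q\<close>, in which \<open>card T - 1\<close> can be
  improved to \<open>card T - 2\<close>, at the cost of an additional \<open>1\<close>, if \<open>card T\<close> is even. Adding up these bounds
  over all subsets gives an error below \<open>n sqrt q / 2\<close> when \<open>n < 2 sqrt q\<close>
  (\<open>card_common_nonsquare_shifts_bound\<close>); for larger \<open>n\<close> the claim is trivial, as its right-hand side is at
  least \<open>q\<close>.

  Most of the work is Weil's bound, for polynomials that split into distinct linear factors. The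
  case of even \<open>card T\<close> follows from the odd one by moving a point of \<open>T\<close> to infinity
  (\<open>Weil_bound_even\<close>). For odd \<open>d = card T\<close> (\<open>Weil_bound_odd\<close>) the character
  \<open>\<psi>(g) = \<Prod>a\<in>T. quad_char (g(a))\<close> on monic polynomials \<open>g\<close> over \<open>F_q\<close> has an L-function
  \<open>L(t) = \<Sum>\<^sub>g \<psi>(g) t^(degree g)\<close>, to which three facts apply.

  \<^item> \<open>L\<close> is a polynomial of degree less than \<open>d\<close>, by Lagrange interpolation
    (\<open>sum_monics_poly_character_eq_0\<close>). Unique factorisation turns its logarithmic derivative into sums
    \<open>S\<^sub>k\<close> over irreducible polynomials of degree dividing \<open>k\<close> (\<open>Newton_identity_monics\<close>); up to sign, \<open>S\<^sub>1\<close> is the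
    character sum \<open>S(T)\<close>.

  \<^item> \<open>S\<^bsub>2k\<^esub>\<close> is a character sum over the field with \<open>q^(2k)\<close> elements, and it is \<open>O(q^k)\<close>
    (\<open>prime_power_sum_even_bound\<close>). This is Stepanov's method in the form given to it by Bombieri: a polynomial of
    degree \<open>q^(2k) / 2 + O(q^k)\<close> is constructed by linear algebra so as to vanish at all points where the
    character takes a prescribed sign (\<open>Stepanov_auxiliary_polynomial\<close>). The extension fields appear only through
    the roots, in the algebraic closure, of irreducible polynomials over \<open>F_q\<close>; the passage from \<open>\<psi>(P)\<close> to
    the character at a root of \<open>P\<close> is a computation of norms (\<open>power_residue_at_root\<close>).

  \<^item> If \<open>L(t) = \<Prod>\<^sub>i (1 - w\<^sub>i t)\<close>, then \<open>S\<^sub>k = - \<Sum>\<^sub>i w\<^sub>i^k\<close>, so the bounds for all large even indices imply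
    \<open>\<bar>w\<^sub>i\<bar> \<le> sqrt q\<close>, whatever the implied constant is (\<open>Riemann_hypothesis_from_power_sum_bound\<close>). For \<open>k = 1\<close> this
    is Weil's bound with its sharp constant.
\<close>

section \<open>The quadratic character of a finite field\<close>

definition quad_char :: "'a::{field,finite} \<Rightarrow> real" where
  "quad_char x = (if x = 0 then 0 else if \<exists>y. x = y ^ 2 then 1 else - 1)"

lemma card_field_gt_1: "CARD('a::{field,finite}) > 1"
proof -
  have "card {0 :: 'a, 1} \<le> CARD('a)"
    by (rule card_mono) auto
  thus ?thesis
    by simp
qed

lemma power_card_minus_1_eq_1:
  fixes x :: "'a::{field,finite}"
  assumes "x \<noteq> 0"
  shows "x ^ (CARD('a) - 1) = 1"
proof -
  let ?U = "UNIV - {0 :: 'a}"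
  have "(\<Prod>y\<in>?U. x * y) = (\<Prod>y\<in>?U. y)"
    by (rule prod.reindex_bij_witness[where j = "\<lambda>y. x * y" and i = "\<lambda>y. y / x"])
       (use assms in auto)
  moreover have "(\<Prod>y\<in>?U. x * y) = x ^ (CARD('a) - 1) * (\<Prod>y\<in>?U. y)"
    by (simp add: prod.distrib card_Diff_singleton)
  moreover have "(\<Prod>y\<in>?U. y) \<noteq> 0"
    by auto
  ultimately show ?thesis
    by simp
qed

lemma power_card_eq_self:
  fixes x :: "'a::{field,finite}"
  shows "x ^ CARD('a) = x"
proof (cases "x = 0")
  case False
  have "x ^ CARD('a) = x * x ^ (CARD('a) - 1)"
    by (metis One_nat_def Suc_pred power_Suc zero_less_card_finite)
  with power_card_minus_1_eq_1[OF False] show ?thesis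
    by simp
qed simp

lemma card_power_eq_const_le:
  fixes c :: "'a::idom"
  assumes "n > 0"
  shows "card {x :: 'a. x ^ n = c} \<le> n"
proof -
  let ?p = "monom 1 n - [:c:]"
  have "coeff ?p n = 1"
    using assms by (cases n) auto
  hence nz: "?p \<noteq> 0"
    by (metis coeff_0 zero_neq_one)
  have "card {x. poly ?p x = 0} \<le> degree ?p"
    using nz by (rule card_poly_roots_bound)
  also have "degree ?p \<le> n"
    by (intro degree_diff_le) (auto simp: degree_monom_le)
  finally show ?thesis
    by (simp add: poly_monom)
qed

lemma one_neq_minus_one_if_odd_card:
  assumes "odd CARD('a::{field,finite})"
  shows "(1 :: 'a) \<noteq> -1"
proof
  assume "(1 :: 'a) = -1"
  hence "of_nat 2 = (0 :: 'a)"
    by (metis add.left_inverse of_nat_1 of_nat_add one_add_one)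
  hence "CHAR('a) dvd 2"
    using of_nat_eq_0_iff_char_dvd by blast
  hence "CHAR('a) = 1 \<or> CHAR('a) = 2"
    by (metis two_is_prime_nat prime_nat_iff)
  moreover have "CHAR('a) \<noteq> 1"
    by (metis of_nat_1 of_nat_CHAR zero_neq_one)
  ultimately have "2 dvd CARD('a)"
    using CHAR_dvd_CARD[where ?'a = 'a] by simp
  with assms show False
    by simp
qed

text \<open>
  With \<open>h = (q - 1) / 2\<close>, all nonzero squares are among the at most \<open>h\<close> roots of \<open>X^h - 1\<close>. Squaring
  is at most two-to-one, so there are at least \<open>h\<close> nonzero squares, and the two sets agree.
\<close>

lemma nonzero_squares_eq_roots:
  assumes "odd CARD('a::{field,finite})"
  shows "{x :: 'a. x \<noteq> 0 \<and> (\<exists>y. x = y ^ 2)} = {x. x ^ ((CARD('a) - 1) div 2) = 1}"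
    and "card {x :: 'a. x ^ ((CARD('a) - 1) div 2) = 1} = (CARD('a) - 1) div 2"
proof -
  let ?h = "(CARD('a) - 1) div 2"
  let ?S = "{x :: 'a. x \<noteq> 0 \<and> (\<exists>y. x = y ^ 2)}"
  let ?R = "{x :: 'a. x ^ ?h = 1}"
  have h: "2 * ?h = CARD('a) - 1"
    using assms by (simp add: even_Suc_div_two)
  have "CARD('a) \<ge> 2"
    using card_field_gt_1[where ?'a = 'a] by simp
  with h have hpos: "?h > 0"
    by linarith
  have sub: "?S \<subseteq> ?R"
  proof safe
    fix y :: 'a assume "y\<^sup>2 \<noteq> 0"
    hence "y \<noteq> 0"
      by auto
    from power_card_minus_1_eq_1[OF this] h show "(y\<^sup>2) ^ ?h = 1"
      by (simp flip: power_mult)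
  qed
  have "UNIV - {0 :: 'a} \<subseteq> (\<Union>s\<in>?S. {y. y ^ 2 = s})"
    by auto
  hence "card (UNIV - {0 :: 'a}) \<le> card (\<Union>s\<in>?S. {y :: 'a. y ^ 2 = s})"
    by (intro card_mono) auto
  also have "\<dots> \<le> (\<Sum>s\<in>?S. card {y :: 'a. y ^ 2 = s})"
    by (rule card_UN_le) auto
  also have "\<dots> \<le> (\<Sum>s\<in>?S. 2)"
    by (intro sum_mono card_power_eq_const_le) auto
  finally have "2 * ?h \<le> 2 * card ?S"
    using h by (simp add: card_Diff_singleton)
  moreover have "card ?R \<le> ?h"
    using hpos by (rule card_power_eq_const_le)
  moreover have "card ?S \<le> card ?R"
    using sub by (intro card_mono) auto
  ultimately have eq: "card ?S = card ?R" and cR: "card ?R = ?h"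
    by linarith+
  show "?S = ?R"
    using sub eq by (intro card_subset_eq) auto
  show "card ?R = ?h"
    by (rule cR)
qed

lemma quad_char_0 [simp]: "quad_char 0 = 0"
  by (simp add: quad_char_def)

lemma quad_char_1 [simp]: "quad_char 1 = 1"
  by (auto simp: quad_char_def intro: exI[of _ 1])

lemma quad_char_eq_0_iff [simp]: "quad_char x = 0 \<longleftrightarrow> x = 0"
  by (simp add: quad_char_def)

lemma quad_char_cases: "quad_char x = 0 \<or> quad_char x = 1 \<or> quad_char x = - 1"
  by (simp add: quad_char_def)

text \<open>
  Since \<open>x^(2 h) = 1\<close> for \<open>x \<noteq> 0\<close>, the power \<open>x^h\<close> is a sign, and by the count above it is \<open>1\<close>
  exactly for squares. Multiplicativity of the character is read off from this.
\<close>

lemma Euler_criterion_quad_char: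
  fixes x :: "'a::{field,finite}"
  assumes "odd CARD('a)"
  shows "quad_char x = 1 \<longleftrightarrow> x ^ ((CARD('a) - 1) div 2) = 1"
    and "quad_char x = - 1 \<longleftrightarrow> x ^ ((CARD('a) - 1) div 2) = - 1"
proof -
  let ?h = "(CARD('a) - 1) div 2"
  show one: "quad_char x = 1 \<longleftrightarrow> x ^ ?h = 1"
    using nonzero_squares_eq_roots(1)[OF assms] by (auto simp: quad_char_def)
  have h: "2 * ?h = CARD('a) - 1"
    using assms by (simp add: even_Suc_div_two)
  have "CARD('a) \<ge> 2"
    using card_field_gt_1[where ?'a = 'a] by simp
  with h have hpos: "?h > 0"
    by linarith
  have neq: "(1 :: 'a) \<noteq> - 1"
    by (rule one_neq_minus_one_if_odd_card[OF assms])
  show "quad_char x = - 1 \<longleftrightarrow> x ^ ?h = - 1"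
  proof (cases "x = 0")
    case False
    have "(x ^ ?h)\<^sup>2 = 1"
      using power_card_minus_1_eq_1[OF False] h by (simp flip: power_mult add: mult.commute)
    hence "x ^ ?h = 1 \<or> x ^ ?h = - 1"
      by (simp add: power2_eq_1_iff)
    with one neq quad_char_cases[of x] False show ?thesis
      by auto
  qed (use hpos neq in \<open>simp add: power_0_left\<close>)
qed

lemma quad_char_mult:
  fixes x y :: "'a::{field,finite}"
  assumes "odd CARD('a)"
  shows "quad_char (x * y) = quad_char x * quad_char y"
proof (cases "x = 0 \<or> y = 0")
  case False
  let ?h = "(CARD('a) - 1) div 2"
  have "quad_char x = 1 \<or> quad_char x = - 1" "quad_char y = 1 \<or> quad_char y = - 1"
    using False quad_char_cases[of x] quad_char_cases[of y] by auto
  thus ?thesis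
    using Euler_criterion_quad_char[OF assms, of x] Euler_criterion_quad_char[OF assms, of y]
      Euler_criterion_quad_char[OF assms, of "x * y"]
    by (auto simp: power_mult_distrib)
qed auto

lemma quad_char_power:
  fixes x :: "'a::{field,finite}"
  assumes "odd CARD('a)"
  shows "quad_char (x ^ n) = quad_char x ^ n"
  by (induction n) (simp_all add: quad_char_mult[OF assms])

lemma quad_char_prod:
  fixes f :: "'b \<Rightarrow> 'a::{field,finite}"
  assumes "odd CARD('a)"
  shows "quad_char (prod f A) = (\<Prod>x\<in>A. quad_char (f x))"
  by (induction A rule: infinite_finite_induct) (simp_all add: quad_char_mult[OF assms])

lemma exists_nonsquare:
  assumes "odd CARD('a::{field,finite})"
  obtains c :: "'a::{field,finite}" where "quad_char c = - 1"
proof -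
  let ?h = "(CARD('a) - 1) div 2"
  have "?h < CARD('a) - 1"
    using card_field_gt_1[where ?'a = 'a] by simp
  have "\<exists>c :: 'a. quad_char c = - 1"
  proof (rule ccontr)
    assume "\<not> ?thesis"
    hence "UNIV - {0 :: 'a} \<subseteq> {x. x ^ ?h = 1}"
      using Euler_criterion_quad_char(1)[OF assms] quad_char_cases by auto
    hence "card (UNIV - {0 :: 'a}) \<le> card {x :: 'a. x ^ ?h = 1}"
      by (intro card_mono) auto
    with nonzero_squares_eq_roots(2)[OF assms] \<open>?h < CARD('a) - 1\<close> show False
      by (simp add: card_Diff_singleton)
  qed
  thus ?thesis
    using that by blast
qed

section \<open>Monic polynomials over a finite field\<close>

definition monics :: "nat \<Rightarrow> 'a::field poly set" where
  "monics m = {g. lead_coeff g = 1 \<and> degree g = m}"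

definition monic_irreds :: "'a::field poly set" where
  "monic_irreds = {P. irreducible P \<and> lead_coeff P = 1}"

lemma monics_0: "monics 0 = {1 :: 'a::field poly}"
  by (auto simp: monics_def elim!: degree_eq_zeroE)

lemma monics_Suc: "monics (Suc m) = (\<lambda>(a, g). pCons a g) ` (UNIV \<times> monics m)"
proof safe
  fix g :: "'a poly" assume g: "g \<in> monics (Suc m)"
  obtain a h where gh: "g = pCons a h"
    by (cases g)
  have "h \<noteq> 0"
    using g by (auto simp: gh monics_def)
  hence "h \<in> monics m"
    using g by (auto simp: gh monics_def)
  thus "g \<in> (\<lambda>(a, g). pCons a g) ` (UNIV \<times> monics m)"
    using gh by auto
next
  fix a and g :: "'a poly" assume g: "g \<in> monics m"
  hence "g \<noteq> 0"
    by (auto simp: monics_def)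
  thus "pCons a g \<in> monics (Suc m)"
    using g by (auto simp: monics_def)
qed

lemma finite_monics [simp]: "finite (monics m :: 'a::{field,finite} poly set)"
  by (induction m) (simp_all add: monics_0 monics_Suc)

lemma card_monics: "card (monics m :: 'a::{field,finite} poly set) = CARD('a) ^ m"
proof (induction m)
  case (Suc m)
  have "inj_on (\<lambda>(a, g). pCons a g) (UNIV \<times> (monics m :: 'a poly set))"
    by (auto simp: inj_on_def)
  thus ?case
    using Suc.IH by (simp add: monics_Suc card_image card_cartesian_product)
qed (simp add: monics_0)

lemma monics_mult:
  assumes "g \<in> monics m" "h \<in> monics n"
  shows "g * h \<in> monics (m + n)"
proof -
  have "g \<noteq> 0" "h \<noteq> 0"
    using assms by (auto simp: monics_def)
  thus ?thesis
    using assms by (auto simp: monics_def degree_mult_eq coeff_mult_degree_sum)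
qed

lemma monics_power:
  assumes "g \<in> monics m"
  shows "g ^ j \<in> monics (j * m)"
proof (induction j)
  case (Suc j)
  thus ?case
    using monics_mult[OF assms Suc.IH] by simp
qed (simp add: monics_0)

lemma monics_cofactor:
  assumes "g * h \<in> monics m" "g \<in> monics n"
  shows "n \<le> m \<and> h \<in> monics (m - n)"
proof -
  have "g \<noteq> 0" "h \<noteq> 0"
    using assms by (auto simp: monics_def)
  thus ?thesis
    using assms by (auto simp: monics_def degree_mult_eq coeff_mult_degree_sum)
qed

lemma monic_irreds_monics: "P \<in> monic_irreds \<Longrightarrow> P \<in> monics (degree P)"
  by (simp add: monic_irreds_def monics_def)

lemma degree_monic_irreds_pos:
  assumes "P \<in> monic_irreds"
  shows "degree P > 0"
proof (rule ccontr)
  assume "\<not> degree P > 0"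
  hence "P \<in> monics 0"
    using monic_irreds_monics[OF assms] by simp
  with assms show False
    by (simp add: monics_0 monic_irreds_def)
qed

lemma prime_elem_monic_irreds: "P \<in> monic_irreds \<Longrightarrow> prime_elem P"
  by (simp add: monic_irreds_def field_poly_irreducible_imp_prime)

lemma monic_irreds_dvd_imp_eq:
  assumes "P \<in> monic_irreds" "Q \<in> monic_irreds" "P dvd Q"
  shows "P = Q"
proof -
  from assms(3) obtain u where u: "Q = P * u"
    by blast
  have "\<not> P dvd 1"
    using assms(1) by (auto simp: monic_irreds_def irreducible_def)
  hence "u dvd 1"
    using assms(2) u by (auto simp: monic_irreds_def irreducible_def)
  hence "degree u = 0"
    by (metis is_unit_poly_iff degree_pCons_0)
  moreover have "u \<in> monics (degree Q - degree P)"
    using monics_cofactor[of P u "degree Q" "degree P"] assms(1,2)[THEN monic_irreds_monics] u by simp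
  ultimately have "u \<in> monics 0"
    by (simp add: monics_def)
  with u show ?thesis
    by (simp add: monics_0)
qed

lemma exists_monic_irreds_dvd:
  fixes g :: "'a::field poly"
  assumes "g \<in> monics m" "m > 0"
  shows "\<exists>P\<in>monic_irreds. P dvd g"
  using assms
proof (induction m arbitrary: g rule: less_induct)
  case (less m)
  show ?case
  proof (cases "irreducible g")
    case True
    thus ?thesis
      using less.prems by (intro bexI[of _ g]) (auto simp: monic_irreds_def monics_def)
  next
    case False
    have "g \<noteq> 0"
      using less.prems by (auto simp: monics_def)
    hence "\<not> g dvd 1"
      using less.prems by (simp add: is_unit_iff_degree monics_def)
    with False \<open>g \<noteq> 0\<close> obtain a b where ab: "g = a * b" "\<not> a dvd 1" "\<not> b dvd 1"
      by (auto simp: irreducible_def)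
    define a' where "a' = smult (inverse (lead_coeff a)) a"
    have nz: "a \<noteq> 0" "b \<noteq> 0"
      using ab \<open>g \<noteq> 0\<close> by auto
    have "degree g = degree a + degree b"
      using nz by (simp add: ab degree_mult_eq)
    moreover have "degree a > 0" "degree b > 0"
      using ab nz by (auto simp: is_unit_iff_degree)
    ultimately have deg: "degree a < m" "degree a > 0"
      using less.prems by (auto simp: monics_def)
    have "a' \<in> monics (degree a)"
      using nz by (simp add: a'_def monics_def)
    from less.IH[OF deg(1) this deg(2)] obtain P where P: "P \<in> monic_irreds" "P dvd a'"
      by blast
    have "a' dvd g"
      using nz by (simp add: a'_def ab smult_dvd_iff)
    with P show ?thesis
      by (meson dvd_trans)
  qed
qed

text \<open>
  Each irreducible \<open>P\<close> occurs here once for every power of \<open>P\<close> dividing \<open>g\<close>, so weighting the pairs by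
  \<open>degree P\<close> gives the degree of \<open>g\<close>: this is the analogue over \<open>F_q[X]\<close> of the convolution of the
  von Mangoldt function with \<open>1\<close> being the logarithm.
\<close>

definition prime_power_divisors :: "'a::field poly \<Rightarrow> ('a poly \<times> nat) set" where
  "prime_power_divisors g = {(P, j). P \<in> monic_irreds \<and> j \<ge> 1 \<and> P ^ j dvd g}"

lemma monics_dvd_degree_le:
  assumes "g \<in> monics m" "P \<in> monics n" "P dvd g"
  shows "n \<le> m"
  using assms monics_cofactor by (metis dvdE)

lemma finite_prime_power_divisors [simp]:
  fixes g :: "'a::{field,finite} poly"
  assumes "g \<in> monics m"
  shows "finite (prime_power_divisors g)"
proof (rule finite_subset)
  show "prime_power_divisors g \<subseteq> (\<Union>i\<le>m. monics i) \<times> {..m}"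
  proof (rule subsetI)
    fix x assume x: "x \<in> prime_power_divisors g"
    obtain P j where x_eq: "x = (P, j)"
      by (cases x)
    note Pj = x[unfolded x_eq]
    hence P: "P \<in> monics (degree P)" "degree P > 0" and j: "j \<ge> 1"
      by (auto simp: prime_power_divisors_def monic_irreds_monics degree_monic_irreds_pos)
    have le: "j * degree P \<le> m"
      using Pj monics_dvd_degree_le[OF assms monics_power[OF P(1)]]
      by (auto simp: prime_power_divisors_def)
    have "j \<le> j * degree P" "degree P \<le> j * degree P"
      using P(2) j by auto
    with le have "j \<le> m" "degree P \<le> m"
      by linarith+
    thus "x \<in> (\<Union>i\<le>m. monics i) \<times> {..m}"
      using P(1) by (auto simp: x_eq)
  qed
qed simp

text \<open>
  Cancelling one prime does not affect divisibility by powers of another, because a prime power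
  dividing a product splits into prime powers dividing the factors.
\<close>

lemma irred_power_dvd_mult_other:
  assumes "P \<in> monic_irreds" "Q \<in> monic_irreds" "P \<noteq> Q"
  shows "Q ^ j dvd P * g \<longleftrightarrow> Q ^ j dvd g"
proof
  assume "Q ^ j dvd P * g"
  with prime_elem_monic_irreds[OF assms(2)] obtain x y
    where xy: "x + y = j" "Q ^ x dvd P" "Q ^ y dvd g"
    by (auto dest: prime_elem_power_dvd_prod)
  have "x = 0"
  proof (rule ccontr)
    assume "x \<noteq> 0"
    hence "Q dvd P"
      using xy(2) by (meson dvd_power dvd_trans gr0I)
    with monic_irreds_dvd_imp_eq assms show False
      by blast
  qed
  with xy show "Q ^ j dvd g"
    by simp
qed simp

lemma degree_eq_sum_prime_power_divisors:
  fixes g :: "'a::{field,finite} poly"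
  assumes "g \<in> monics m"
  shows "(\<Sum>(P, j)\<in>prime_power_divisors g. degree P) = m"
  using assms
proof (induction m arbitrary: g rule: less_induct)
  case (less m)
  show ?case
  proof (cases "m = 0")
    case True
    hence "g = 1"
      using less.prems by (simp add: monics_0)
    have "prime_power_divisors g = {}"
    proof safe
      fix P j assume "(P, j) \<in> prime_power_divisors g"
      hence "P dvd 1" "P \<in> monic_irreds"
        unfolding prime_power_divisors_def \<open>g = 1\<close>
        by (auto simp: is_unit_power_iff)
      thus "(P, j) \<in> {}"
        by (auto simp: monic_irreds_def irreducible_def)
    qed
    with True show ?thesis
      by simp
  next
    case False
    then obtain P h where P: "P \<in> monic_irreds" and g: "g = P * h"
      using exists_monic_irreds_dvd[OF less.prems] by blast
    have h: "degree P \<le> m" "h \<in> monics (m - degree P)"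
      using monics_cofactor[of P h m "degree P"] less.prems monic_irreds_monics[OF P] g by auto
    define E where "E = {(Q, j) \<in> prime_power_divisors h. Q \<noteq> P}"
    define F where "F = {j. (P, j) \<in> prime_power_divisors h}"
    have fin: "finite E" "finite F"
    proof -
      have "finite (prime_power_divisors h)"
        using h(2) by simp
      moreover have "Pair P ` F \<subseteq> prime_power_divisors h"
        by (auto simp: F_def)
      ultimately show "finite F"
        by (meson finite_subset finite_imageD inj_onI Pair_inject)
      show "finite E"
        using \<open>finite (prime_power_divisors h)\<close> unfolding E_def
        by (rule rev_finite_subset) auto
    qed
    have "P \<noteq> 0"
      using P by (auto simp: monic_irreds_def)
    have h_eq: "prime_power_divisors h = E \<union> Pair P ` F"
      by (auto simp: E_def F_def)
    have g_eq: "prime_power_divisors g = E \<union> Pair P ` (insert 1 (Suc ` F))"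
    proof (rule Set.set_eqI, rule iffI)
      fix x assume x: "x \<in> prime_power_divisors g"
      obtain Q j where [simp]: "x = (Q, j)"
        by (cases x)
      show "x \<in> E \<union> Pair P ` (insert 1 (Suc ` F))"
      proof (cases "Q = P")
        case True
        with x obtain i where i: "j = Suc i"
          by (cases j) (auto simp: prime_power_divisors_def)
        have "P ^ i dvd h"
          using x True \<open>P \<noteq> 0\<close> by (simp add: prime_power_divisors_def g i)
        hence "i = 0 \<or> i \<in> F"
          using P by (cases i) (auto simp: F_def prime_power_divisors_def)
        with i True show ?thesis
          by auto
      next
        case False
        thus ?thesis
          using x P irred_power_dvd_mult_other[of P Q j h]
          by (auto simp: prime_power_divisors_def E_def g)
      qed
    next
      fix x assume x: "x \<in> E \<union> Pair P ` (insert 1 (Suc ` F))"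
      obtain Q j where [simp]: "x = (Q, j)"
        by (cases x)
      from x show "x \<in> prime_power_divisors g"
        using P by (auto simp: prime_power_divisors_def E_def F_def g)
    qed
    have sum_P: "(\<Sum>(Q, j)\<in>Pair P ` A. degree Q) = card A * degree P" for A :: "nat set"
      by (subst sum.reindex) (auto simp: inj_on_def)
    have disj: "E \<inter> Pair P ` A = {}" for A
      by (auto simp: E_def)
    have "0 \<notin> F"
      by (auto simp: F_def prime_power_divisors_def)
    hence card_F: "card (insert (Suc 0) (Suc ` F)) = Suc (card F)"
      using fin by (subst card_insert_disjoint) (auto simp: card_image)
    have "(\<Sum>(P, j)\<in>prime_power_divisors g. degree P) =
            (\<Sum>(P, j)\<in>E. degree P) + Suc (card F) * degree P"
      unfolding g_eq using fin disj by (subst sum.union_disjoint) (auto simp: sum_P card_F simp del: image_insert)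
    also have "\<dots> = (\<Sum>(P, j)\<in>prime_power_divisors h. degree P) + degree P"
      unfolding h_eq using fin disj by (subst sum.union_disjoint) (auto simp: sum_P)
    also have "\<dots> = m"
      using less.IH[OF _ h(2)] h(1) degree_monic_irreds_pos[OF P] by simp
    finally show ?thesis .
  qed
qed

text \<open>
  The coefficient of \<open>t^k\<close> in \<open>t L'(t) / L(t)\<close>, where \<open>L(t)\<close> is the Euler product of
  \<open>1 / (1 - \<psi>(P) t^(degree P))\<close> over the monic irreducible polynomials \<open>P\<close>.
\<close>

definition prime_power_sum :: "('a::field poly \<Rightarrow> real) \<Rightarrow> nat \<Rightarrow> real" where
  "prime_power_sum \<psi> k =
     (\<Sum>P\<in>{P \<in> monic_irreds. degree P dvd k}. real (degree P) * \<psi> P ^ (k div degree P))"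

lemma finite_irreds_degree_dvd [simp]:
  assumes "k > 0"
  shows "finite {P :: 'a::{field,finite} poly. P \<in> monic_irreds \<and> degree P dvd k}"
proof (rule finite_subset)
  show "{P :: 'a poly. P \<in> monic_irreds \<and> degree P dvd k} \<subseteq> (\<Union>i\<le>k. monics i)"
    using assms monic_irreds_monics by (auto dest!: dvd_imp_le)
qed simp

text \<open>
  Coefficientwise this is \<open>t L' = L \<cdot> (t L' / L)\<close> for \<open>L(t) = \<Sum>\<^sub>g \<psi>(g) t^(degree g)\<close>. To prove it without
  infinite products, the factor \<open>m = degree g\<close> on the left is distributed over the prime powers
  \<open>P^j\<close> dividing \<open>g\<close>, and \<open>g\<close> is replaced by its cofactor \<open>h = g / P^j\<close>; the index on the right is
  \<open>k = j \<cdot> degree P\<close>.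
\<close>

lemma Newton_identity_monics:
  fixes \<psi> :: "'a::{field,finite} poly \<Rightarrow> real"
  assumes mult: "\<And>g h. \<psi> (g * h) = \<psi> g * \<psi> h" and one: "\<psi> 1 = 1"
  shows "real m * (\<Sum>g\<in>monics m. \<psi> g) =
           (\<Sum>k=1..m. prime_power_sum \<psi> k * (\<Sum>g\<in>monics (m - k). \<psi> g))"
proof -
  let ?I = "\<lambda>k. {P :: 'a poly. P \<in> monic_irreds \<and> degree P dvd k}"
  have pow: "\<psi> (g ^ j) = \<psi> g ^ j" for g j
    by (induction j) (simp_all add: mult one)
  have "real m * (\<Sum>g\<in>monics m. \<psi> g) = (\<Sum>g\<in>monics m. real m * \<psi> g)"
    by (simp add: sum_distrib_left)
  also have "\<dots> = (\<Sum>g\<in>monics m. \<Sum>(P, j)\<in>prime_power_divisors g. real (degree P) * \<psi> g)"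
  proof (rule sum.cong)
    fix g :: "'a poly" assume g: "g \<in> monics m"
    have "real m = (\<Sum>(P, j)\<in>prime_power_divisors g. real (degree P))"
      by (subst degree_eq_sum_prime_power_divisors[OF g, symmetric])
         (simp add: case_prod_unfold)
    thus "real m * \<psi> g = (\<Sum>(P, j)\<in>prime_power_divisors g. real (degree P) * \<psi> g)"
      by (simp add: sum_distrib_right case_prod_unfold)
  qed simp
  also have "\<dots> = (\<Sum>(g, P, j)\<in>Sigma (monics m) prime_power_divisors. real (degree P) * \<psi> g)"
    by (subst sum.Sigma) auto
  also have "\<dots> = (\<Sum>(k, P, h)\<in>Sigma {1..m} (\<lambda>k. ?I k \<times> monics (m - k)).
                     real (degree P) * \<psi> P ^ (k div degree P) * \<psi> h)"
  proof (rule sum.reindex_bij_witness[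
        where i = "\<lambda>(k, P, h). (P ^ (k div degree P) * h, P, k div degree P)"
          and j = "\<lambda>(g, P, j). (j * degree P, P, g div P ^ j)"], goal_cases)
    case (1 x)
    then obtain g P j where x: "x = (g, P, j)" "g \<in> monics m" "P \<in> monic_irreds" "j \<ge> 1" "P ^ j dvd g"
      by (auto simp: prime_power_divisors_def)
    thus ?case
      using degree_monic_irreds_pos[OF x(3)] by simp
  next
    case (2 x)
    then obtain g P j where x: "x = (g, P, j)" "g \<in> monics m" "P \<in> monic_irreds" "j \<ge> 1" "P ^ j dvd g"
      by (auto simp: prime_power_divisors_def)
    have "g = P ^ j * (g div P ^ j)"
      using x(5) by simp
    hence "j * degree P \<le> m \<and> g div P ^ j \<in> monics (m - j * degree P)"
      using monics_cofactor[of "P ^ j" "g div P ^ j" m "j * degree P"] x(2)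
        monics_power[OF monic_irreds_monics[OF x(3)], of j] by simp
    thus ?case
      using x degree_monic_irreds_pos[OF x(3)] by (simp add: Suc_le_eq)
  next
    case (3 y)
    then obtain k P h where y: "y = (k, P, h)" "P \<in> monic_irreds" "degree P dvd k" "h \<in> monics (m - k)"
      by auto
    have "P ^ (k div degree P) \<noteq> 0"
      using y(2) by (auto simp: monic_irreds_def)
    thus ?case
      using y by simp
  next
    case (4 y)
    then obtain k P h where y: "y = (k, P, h)" "P \<in> monic_irreds" "degree P dvd k" "h \<in> monics (m - k)"
        "1 \<le> k" "k \<le> m"
      by auto
    have "P ^ (k div degree P) \<in> monics k"
      using monics_power[OF monic_irreds_monics[OF y(2)], of "k div degree P"] y(3) by simp
    hence "P ^ (k div degree P) * h \<in> monics m"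
      using monics_mult[OF _ y(4), of "P ^ (k div degree P)" k] y by simp
    moreover have "k div degree P \<ge> 1"
      using y(3,5) degree_monic_irreds_pos[OF y(2)] by (auto elim!: dvdE)
    ultimately show ?case
      using y by (simp add: prime_power_divisors_def)
  next
    case (5 x)
    then obtain g P j where x: "x = (g, P, j)" "g \<in> monics m" "P \<in> monic_irreds" "j \<ge> 1" "P ^ j dvd g"
      by (auto simp: prime_power_divisors_def)
    have "\<psi> g = \<psi> P ^ j * \<psi> (g div P ^ j)"
      using x(5) by (simp flip: pow mult)
    thus ?case
      using x degree_monic_irreds_pos[OF x(3)] by simp
  qed
  also have "\<dots> = (\<Sum>k=1..m. \<Sum>(P, h)\<in>?I k \<times> monics (m - k).
                     real (degree P) * \<psi> P ^ (k div degree P) * \<psi> h)"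
    by (subst sum.Sigma) auto
  also have "\<dots> = (\<Sum>k=1..m. prime_power_sum \<psi> k * (\<Sum>g\<in>monics (m - k). \<psi> g))"
    unfolding prime_power_sum_def
    by (intro sum.cong refl) (simp add: sum_product sum.cartesian_product)
  finally show ?thesis .
qed

text \<open>
  For the trivial character the coefficients of \<open>L\<close> are \<open>q^m\<close>, and the recursion above determines its
  power sums. This is the count of points of the field with \<open>q^k\<close> elements, grouped by minimal
  polynomial.
\<close>

lemma sum_degree_monic_irreds:
  assumes "k > 0"
  shows "(\<Sum>P\<in>{P :: 'a::{field,finite} poly. P \<in> monic_irreds \<and> degree P dvd k}. real (degree P)) =
           real CARD('a) ^ k"
proof -
  let ?q = "real CARD('a)"
  let ?S = "prime_power_sum (\<lambda>_ :: 'a poly. 1 :: real)"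
  have "?S k = ?q ^ k"
    using assms
  proof (induction k rule: less_induct)
    case (less k)
    have "real k * ?q ^ k = (\<Sum>j=1..k. ?S j * ?q ^ (k - j))"
      using Newton_identity_monics[of "\<lambda>_ :: 'a poly. 1 :: real" k] by (simp add: card_monics)
    also have "{1..k} = insert k {1..<k}"
      using less.prems by auto
    also have "(\<Sum>j\<in>insert k {1..<k}. ?S j * ?q ^ (k - j)) = ?S k + (\<Sum>j\<in>{1..<k}. ?S j * ?q ^ (k - j))"
      by simp
    also have "(\<Sum>j\<in>{1..<k}. ?S j * ?q ^ (k - j)) = (\<Sum>j\<in>{1..<k}. ?q ^ k)"
      using less.IH by (intro sum.cong) (auto simp flip: power_add)
    finally show ?case
      using less.prems by (simp add: of_nat_diff algebra_simps)
  qed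
  thus ?thesis
    by (simp add: prime_power_sum_def)
qed

section \<open>Bounding the inverse roots of an L-polynomial\<close>

text \<open>
  Cancellation between the powers cannot persist: by simultaneous Diophantine approximation of the
  arguments there are arbitrarily large \<open>k\<close> for which all \<open>w j ^ k\<close> lie within 60 degrees of the positive
  real axis. For those \<open>k\<close> the sum is at least half of any single \<open>norm (w i) ^ k\<close>, which would be
  unbounded if \<open>norm (w i) > 1\<close>.
\<close>

lemma bounded_power_sums_imp_norm_le_1:
  fixes w :: "nat \<Rightarrow> complex"
  assumes bound: "\<And>k. k \<ge> K \<Longrightarrow> norm (\<Sum>i<n. w i ^ k) \<le> B" and i: "i < n"
  shows "norm (w i) \<le> 1"
proof (rule ccontr)
  assume "\<not> norm (w i) \<le> 1"
  hence rho: "norm (w i) > 1"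
    by simp
  obtain K1 where K1: "2 * B < norm (w i) ^ K1"
    using real_arch_pow[OF rho] by blast
  define K0 where "K0 = Suc (K + K1)"
  (* Approximating the K0-fold angles makes the exponent k below a multiple of K0, hence large.
     Precision 1/6 of a full turn is 60 degrees, where the cosine is 1/2. *)
  have "\<exists>t p. 0 < t \<and> (\<forall>j<n. \<bar>of_int t * (real K0 * Arg (w j) / (2 * pi)) - of_int (p j)\<bar> < 1 / real 6)"
    by (rule Dirichlet_approx_simult[of 6 n "\<lambda>j. real K0 * Arg (w j) / (2 * pi)"]) (simp, blast)
  then obtain t :: int and p where t: "0 < t"
      and tp: "\<And>j. j < n \<Longrightarrow> \<bar>of_int t * (real K0 * Arg (w j) / (2 * pi)) - of_int (p j)\<bar> < 1 / real 6"
    by blast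
  define k where "k = K0 * nat t"
  have "nat t \<ge> 1"
    using t by linarith
  hence kK: "k \<ge> K0"
    by (simp add: k_def)
  have Re: "Re (w j ^ k) \<ge> norm (w j) ^ k / 2" if j: "j < n" for j
  proof -
    define x where "x = of_int t * (real K0 * Arg (w j) / (2 * pi)) - of_int (p j)"
    have kA: "real k * Arg (w j) = 2 * pi * x + 2 * pi * of_int (p j)"
      using t by (simp add: x_def k_def field_simps)
    have "cos (real k * Arg (w j)) = cos (2 * pi * x)"
      unfolding kA cos_add by simp
    also have "\<dots> = cos \<bar>2 * pi * x\<bar>"
      by simp
    also have "\<dots> \<ge> cos (pi / 3)"
    proof (rule cos_monotone_0_pi_le)
      have "\<bar>x\<bar> \<le> 1 / 6"
        using tp[OF j] by (simp add: x_def)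
      hence "2 * pi * \<bar>x\<bar> \<le> 2 * pi * (1 / 6)"
        by (intro mult_left_mono) auto
      thus "\<bar>2 * pi * x\<bar> \<le> pi / 3"
        by (simp add: abs_mult)
    qed auto
    finally have c: "cos (real k * Arg (w j)) \<ge> 1 / 2"
      by (simp add: cos_60)
    have "w j ^ k = rcis (norm (w j)) (Arg (w j)) ^ k"
      by (simp add: rcis_cmod_Arg)
    also have "\<dots> = rcis (norm (w j) ^ k) (real k * Arg (w j))"
      by (rule DeMoivre2)
    finally have "Re (w j ^ k) = norm (w j) ^ k * cos (real k * Arg (w j))"
      by simp
    also have "\<dots> \<ge> norm (w j) ^ k * (1 / 2)"
      using c by (intro mult_left_mono) auto
    finally show ?thesis
      by simp
  qed
  have "B < norm (w i) ^ K1 / 2"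
    using K1 by simp
  also have "\<dots> \<le> norm (w i) ^ k / 2"
    using rho kK by (simp add: K0_def power_increasing)
  also have "\<dots> \<le> (\<Sum>j<n. norm (w j) ^ k / 2)"
    using i by (intro member_le_sum) auto
  also have "\<dots> \<le> (\<Sum>j<n. Re (w j ^ k))"
    using Re by (intro sum_mono) auto
  also have "\<dots> = Re (\<Sum>j<n. w j ^ k)"
    by simp
  also have "\<dots> \<le> norm (\<Sum>j<n. w j ^ k)"
    by (rule complex_Re_le_cmod)
  also have "\<dots> \<le> B"
    using kK by (intro bound) (simp add: K0_def)
  finally show False
    by simp
qed

text \<open>
  The logarithmic derivative of \<open>\<Prod>i<n. 1 - w i X\<close>, with the denominators cleared.
\<close>

lemma fps_X_times_deriv_prod_linear:
  fixes w :: "nat \<Rightarrow> complex"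
  defines "F \<equiv> \<lambda>n. \<Prod>i<n. 1 - fps_const (w i) * fps_X"
  shows "fps_X * fps_deriv (F n) =
           - Abs_fps (\<lambda>k. if k = 0 then 0 else \<Sum>i<n. w i ^ k) * F n"
proof (induction n)
  case 0
  show ?case
    unfolding F_def by (rule fps_ext) auto
next
  case (Suc n)
  define g where "g = (1 - fps_const (w n) * fps_X)"
  define P where "P = (\<lambda>n. Abs_fps (\<lambda>k. if k = 0 then 0 else \<Sum>i<n. w i ^ k))"
  define p where "p = Abs_fps (\<lambda>k. if k = 0 then 0 else w n ^ k)"
  have pg: "p * g = fps_const (w n) * fps_X"
  proof (rule fps_ext)
    fix m
    have "p * g = p - fps_const (w n) * (fps_X * p)"
      by (simp add: g_def algebra_simps)
    thus "fps_nth (p * g) m = fps_nth (fps_const (w n) * fps_X) m"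
      by (cases m rule: nat.exhaust) (auto simp: p_def power_0_left split: nat.splits)
  qed
  have P: "P (Suc n) = P n + p"
    by (rule fps_ext) (simp add: P_def p_def)
  have F: "F (Suc n) = F n * g"
    by (simp add: F_def g_def)
  have "fps_deriv g = - fps_const (w n)"
    by (simp add: g_def)
  hence dg: "fps_X * fps_deriv g = - (p * g)"
    by (simp only: pg mult_minus_right) (simp add: mult.commute)
  have "fps_X * fps_deriv (F (Suc n)) = (fps_X * fps_deriv (F n)) * g + F n * (fps_X * fps_deriv g)"
    by (simp add: F algebra_simps)
  also have "\<dots> = (- P n * F n) * g - F n * (p * g)"
    using Suc.IH by (simp only: P_def dg mult_minus_right diff_conv_add_uminus)
  also have "\<dots> = - P (Suc n) * F (Suc n)"
    by (simp add: P F algebra_simps)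
  finally show ?case
    by (simp add: P_def)
qed

text \<open>
  The recursion says that \<open>S\<close> is the sequence of coefficients of the logarithmic derivative of the
  polynomial \<open>\<Sum>\<^sub>m c m t^m\<close> of degree less than \<open>d\<close>. Writing this polynomial as \<open>\<Prod>\<^sub>i (1 - w i t)\<close> gives
  \<open>S k = - \<Sum>\<^sub>i w i ^ k\<close>. A bound of the right order on all late even-indexed terms, with an arbitrary
  constant \<open>B\<close>, forces \<open>norm (w i) \<le> sqrt q\<close>; the constant then disappears from the bound on \<open>S 1\<close>.
\<close>

lemma Riemann_hypothesis_from_power_sum_bound:
  fixes c S :: "nat \<Rightarrow> complex" and q :: real
  assumes c0: "c 0 = 1" and c_eq_0: "\<And>m. m \<ge> d \<Longrightarrow> c m = 0" and q: "q > 0"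
    and newton: "\<And>m. of_nat m * c m = (\<Sum>k=1..m. S k * c (m - k))"
    and bound: "\<And>k. k \<ge> K \<Longrightarrow> norm (S (2 * k)) \<le> B * q ^ k"
  shows "norm (S 1) \<le> (real d - 1) * sqrt q"
proof -
  have d: "d > 0"
    using c0 c_eq_0[of 0] by (cases d) auto
  define C where "C = Poly (map c [0..<d])"
  have coeff_C: "coeff C m = c m" for m
    using c_eq_0[of m] by (auto simp: C_def nth_default_def)
  have C0: "coeff C 0 \<noteq> 0"
    by (simp add: coeff_C c0)
  have "C \<noteq> 0"
    using C0 by auto
  have deg_C: "degree C \<le> d - 1"
    using c_eq_0 d by (intro degree_le) (auto simp: coeff_C)
  define n where "n = degree C"
  have "lead_coeff (reflect_poly C) = 1"
    using C0 c0 by (simp add: coeff_C coeff_reflect_poly)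
  moreover obtain w where "smult (lead_coeff (reflect_poly C))
      (\<Prod>i<degree (reflect_poly C). [:- w i, 1:]) = reflect_poly C"
    using complex_poly_decompose' by blast
  ultimately have w: "(\<Prod>i<n. [:- w i, 1:]) = reflect_poly C"
    using C0 by (simp add: n_def)
  (* Since the constant coefficient of C is nonzero, reversing the coefficients twice gives C back,
     so a factorisation of the reversed polynomial into monic factors yields one of C. *)
  have refl_linear: "reflect_poly [:- a, 1:] = [:1, - a:]" for a :: complex
    by (cases "a = 0") (auto simp: reflect_poly_def cCons_def)
  have "C = reflect_poly (reflect_poly C)"
    using C0 by simp
  also have "\<dots> = (\<Prod>i<n. [:1, - w i:])"
    by (simp flip: w add: reflect_poly_prod refl_linear)
  finally have C_prod: "C = (\<Prod>i<n. [:1, - w i:])" .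
  define F where "F = fps_of_poly C"
  have "fps_of_poly [:1, - a:] = 1 - fps_const a * fps_X" for a :: complex
    by (simp add: fps_of_poly_pCons)
  note linear = this
  have F_prod: "F = (\<Prod>i<n. 1 - fps_const (w i) * fps_X)"
    by (simp only: F_def C_prod fps_of_poly_prod linear)
  have "F \<noteq> 0"
    using \<open>C \<noteq> 0\<close> by (simp add: F_def)
  define Sf where "Sf = Abs_fps (\<lambda>k. if k = 0 then 0 else S k)"
  define Pf where "Pf = Abs_fps (\<lambda>k. if k = 0 then 0 else \<Sum>i<n. w i ^ k)"
  have "fps_X * fps_deriv F = Sf * F"
  proof (rule fps_ext)
    fix m
    have "fps_nth (fps_X * fps_deriv F) m = of_nat m * c m"
      by (cases m) (auto simp: F_def coeff_C)
    also have "\<dots> = (\<Sum>k=1..m. S k * c (m - k))"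
      by (rule newton)
    also have "\<dots> = (\<Sum>k=0..m. fps_nth Sf k * c (m - k))"
      by (rule sum.mono_neutral_cong_left) (auto simp: Sf_def)
    also have "\<dots> = fps_nth (Sf * F) m"
      by (simp add: fps_mult_nth F_def coeff_C)
    finally show "fps_nth (fps_X * fps_deriv F) m = fps_nth (Sf * F) m" .
  qed
  moreover have "fps_X * fps_deriv F = - Pf * F"
    unfolding F_prod Pf_def by (rule fps_X_times_deriv_prod_linear)
  ultimately have "Sf = - Pf"
    using \<open>F \<noteq> 0\<close> by (metis mult_right_cancel)
  have S_eq: "S k = - (\<Sum>i<n. w i ^ k)" if "k > 0" for k
  proof -
    have "fps_nth Sf k = fps_nth (- Pf) k"
      by (simp only: \<open>Sf = - Pf\<close>)
    thus ?thesis
      using that by (simp add: Sf_def Pf_def)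
  qed
  have norm_w: "norm (w i) \<le> sqrt q" if "i < n" for i
  proof -
    (* Only even indices are controlled, so the criterion is applied to the squares. *)
    have "norm (w i ^ 2 / of_real q) \<le> 1"
    proof (rule bounded_power_sums_imp_norm_le_1[where w = "\<lambda>i. w i ^ 2 / of_real q" and n = n
          and K = "Suc K" and B = B])
      fix k assume "k \<ge> Suc K"
      hence k: "k > 0" "k \<ge> K"
        by auto
      have "(\<Sum>i<n. (w i ^ 2 / of_real q) ^ k) = (\<Sum>i<n. w i ^ (2 * k)) / of_real (q ^ k)"
        by (simp add: power_divide sum_divide_distrib flip: power_mult)
      also have "\<dots> = - S (2 * k) / of_real (q ^ k)"
        using k by (simp add: S_eq)
      finally have "norm (\<Sum>i<n. (w i ^ 2 / of_real q) ^ k) = norm (S (2 * k)) / q ^ k"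
        using q by (simp add: norm_divide norm_power)
      also have "\<dots> \<le> B"
        using bound[OF k(2)] q by (simp add: field_simps)
      finally show "norm (\<Sum>i<n. (w i ^ 2 / of_real q) ^ k) \<le> B" .
    qed (use that in auto)
    hence "norm (w i) ^ 2 \<le> q"
      using q by (simp add: norm_divide norm_power field_simps)
    thus ?thesis
      by (simp add: real_le_rsqrt)
  qed
  have "norm (S 1) \<le> (\<Sum>i<n. norm (w i))"
    by (simp add: S_eq norm_sum)
  also have "\<dots> \<le> (\<Sum>i<n. sqrt q)"
    by (intro sum_mono norm_w) auto
  also have "\<dots> \<le> (real d - 1) * sqrt q"
    using deg_C d q by (auto simp: n_def intro!: mult_right_mono)
  finally show ?thesis .
qed

section \<open>Roots of irreducible polynomials in the algebraic closure\<close>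

definition ac_poly :: "'a::field poly \<Rightarrow> 'a alg_closure \<Rightarrow> 'a alg_closure" where
  "ac_poly g = poly (map_poly to_ac g)"

lemma ac_poly_0 [simp]: "ac_poly 0 z = 0"
  and ac_poly_1 [simp]: "ac_poly 1 z = 1"
  by (simp_all add: ac_poly_def)

lemma ac_poly_pCons [simp]: "ac_poly (pCons a g) z = to_ac a + z * ac_poly g z"
  by (simp add: ac_poly_def map_poly_pCons)

lemma ac_poly_add [simp]: "ac_poly (g + h) z = ac_poly g z + ac_poly h z"
  by (induction g h rule: poly_induct2) (simp_all add: algebra_simps)

lemma ac_poly_smult [simp]: "ac_poly (smult c g) z = to_ac c * ac_poly g z"
  by (induction g) (simp_all add: algebra_simps)

lemma ac_poly_mult [simp]: "ac_poly (g * h) z = ac_poly g z * ac_poly h z"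
  by (induction g) (simp_all add: algebra_simps)

lemma ac_poly_minus [simp]: "ac_poly (- g) z = - ac_poly g z"
  using ac_poly_smult[of "- 1" g z] by simp

lemma ac_poly_diff [simp]: "ac_poly (g - h) z = ac_poly g z - ac_poly h z"
  using ac_poly_add[of g "- h" z] by simp

lemma ac_poly_power [simp]: "ac_poly (g ^ n) z = ac_poly g z ^ n"
  by (induction n) simp_all

lemma ac_poly_prod: "ac_poly (prod f A) z = (\<Prod>x\<in>A. ac_poly (f x) z)"
  by (induction A rule: infinite_finite_induct) simp_all

lemma ac_poly_sum: "ac_poly (sum f A) z = (\<Sum>x\<in>A. ac_poly (f x) z)"
  by (induction A rule: infinite_finite_induct) simp_all

lemma ac_poly_monom [simp]: "ac_poly (monom c n) z = to_ac c * z ^ n"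
  by (simp add: ac_poly_def map_poly_monom poly_monom)

lemma ac_poly_to_ac: "ac_poly g (to_ac a) = to_ac (poly g a)"
  by (induction g) simp_all

lemma map_poly_to_ac_eq_0_iff [simp]: "map_poly to_ac g = 0 \<longleftrightarrow> g = 0"
  by (subst map_poly_eq_0_iff) auto

lemma degree_map_poly_to_ac [simp]: "degree (map_poly to_ac g) = degree g"
  by (rule degree_map_poly) auto

lemma exists_ac_root:
  assumes "degree g > 0"
  obtains z where "ac_poly g z = 0"
  using alg_closed_imp_poly_has_root[of "map_poly to_ac g"] assms by (auto simp: ac_poly_def)

text \<open>
  Euclid's algorithm in the form of an induction on the degree: the remainders of \<open>P\<close> modulo \<open>g\<close> and of
  \<open>g\<close> modulo \<open>P\<close> are again annihilated, and if \<open>g\<close> divides \<open>P\<close>, it is associated to \<open>P\<close>.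
\<close>

lemma irreducible_dvd_iff_ac_root:
  fixes P g :: "'a::field poly"
  assumes "irreducible P" "ac_poly P z = 0"
  shows "P dvd g \<longleftrightarrow> ac_poly g z = 0"
proof
  assume "P dvd g"
  thus "ac_poly g z = 0"
    using assms(2) by (auto elim!: dvdE)
next
  assume "ac_poly g z = 0"
  thus "P dvd g"
  proof (induction "degree g" arbitrary: g rule: less_induct)
    case (less g)
    show ?case
    proof (cases "g = 0")
      case False
      have "\<not> degree g = 0"
      proof
        assume "degree g = 0"
        then obtain c where "g = [:c:]"
          by (elim degree_eq_zeroE)
        with less.prems False show False
          by simp
      qed
      define R where "R = P mod g"
      have R: "ac_poly R z = 0"
        using less.prems assms(2) by (simp add: R_def flip: minus_div_mult_eq_mod)
      show ?thesis
      proof (cases "R = 0")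
        case True
        hence "g dvd P"
          by (simp add: R_def dvd_eq_mod_eq_0)
        then obtain u where u: "P = g * u"
          by blast
        have "\<not> g dvd 1"
          using \<open>degree g \<noteq> 0\<close> False by (simp add: is_unit_iff_degree)
        hence "u dvd 1"
          using assms(1) u by (auto simp: irreducible_def)
        thus ?thesis
          using u by (simp add: mult_unit_dvd_iff)
      next
        case False
        hence "degree R < degree g"
          unfolding R_def using \<open>degree g \<noteq> 0\<close> degree_mod_less' \<open>g \<noteq> 0\<close> by blast
        from less.hyps[OF this R] have "P dvd R" .
        hence "degree P \<le> degree R"
          using False by (rule dvd_imp_degree_le)
        with \<open>degree R < degree g\<close> have "P mod g = P"
          by (intro mod_poly_less) simp
        hence "degree P < degree g"
          using \<open>degree R < degree g\<close> by (simp add: R_def)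
        have 1: "ac_poly (g mod P) z = 0"
          using less.prems assms(2) by (simp flip: minus_div_mult_eq_mod)
        have "P \<noteq> 0"
          using assms(1) by auto
        have "degree (g mod P) < degree g"
        proof (cases "g mod P = 0")
          case False
          thus ?thesis
            using degree_mod_less'[of P g] \<open>P \<noteq> 0\<close> \<open>degree P < degree g\<close> by linarith
        qed (use \<open>degree g \<noteq> 0\<close> in auto)
        from less.hyps[OF this 1] show ?thesis
          by (simp add: dvd_mod_iff)
      qed
    qed simp
  qed
qed

lemma prod_lessThan_add:
  fixes f :: "nat \<Rightarrow> 'b::comm_monoid_mult"
  shows "(\<Prod>i<a + b. f i) = (\<Prod>i<a. f i) * (\<Prod>i<b. f (a + i))"
  by (induction b) (simp_all add: mult.assoc)

lemma CHAR_eq_if_card_eq_prime_power: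
  assumes "prime p" "CARD('a::{field,finite}) = p ^ k"
  shows "CHAR('a) = p"
proof -
  have "CHAR('a) dvd p ^ k"
    using CHAR_dvd_CARD[where ?'a = 'a] assms(2) by simp
  moreover have "prime CHAR('a)"
    by (rule prime_CHAR_semidom, rule finite_imp_CHAR_pos) simp
  ultimately show ?thesis
    using assms(1) by (metis prime_dvd_power primes_dvd_imp_eq)
qed

context
  fixes p e :: nat
  assumes prime_p: "prime p" and card_eq: "CARD('a::{field,finite}) = p ^ e"
begin

text \<open>
  From here on \<open>q\<close> is a power of the characteristic, so that raising to the power \<open>q^k\<close> is an
  endomorphism of the algebraic closure which fixes the base field.
\<close>

lemma frobenius_sum:
  fixes f :: "'b \<Rightarrow> 'a alg_closure"
  shows "(\<Sum>x\<in>A. f x) ^ (CARD('a) ^ k) = (\<Sum>x\<in>A. f x ^ (CARD('a) ^ k))"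
proof (rule freshmans_dream_sum')
  show "prime CHAR('a alg_closure)"
    using CHAR_eq_if_card_eq_prime_power[OF prime_p card_eq] prime_p by simp
  show "CARD('a) ^ k = CHAR('a alg_closure) ^ (e * k)"
    using CHAR_eq_if_card_eq_prime_power[OF prime_p card_eq] card_eq by (simp add: power_mult)
qed

lemma frobenius_diff:
  fixes x y :: "'a alg_closure"
  shows "(x - y) ^ (CARD('a) ^ k) = x ^ (CARD('a) ^ k) - y ^ (CARD('a) ^ k)"
proof -
  have "x ^ (CARD('a) ^ k) = ((x - y) + y) ^ (CARD('a) ^ k)"
    by simp
  also have "\<dots> = (x - y) ^ (CARD('a) ^ k) + y ^ (CARD('a) ^ k)"
    using frobenius_sum[where A = "{False, True}" and f = "\<lambda>b. if b then y else x - y" and k = k] by simp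
  finally show ?thesis
    by simp
qed

lemma to_ac_power_card_power: "to_ac (a :: 'a) ^ (CARD('a) ^ k) = to_ac a"
proof (induction k)
  case (Suc k)
  have "to_ac a ^ (CARD('a) ^ Suc k) = (to_ac a ^ (CARD('a) ^ k)) ^ CARD('a)"
    by (simp add: mult.commute flip: power_mult)
  also have "\<dots> = to_ac (a ^ CARD('a))"
    using Suc.IH by simp
  finally show ?case
    using power_card_eq_self[of a] by simp
qed simp

lemma ac_poly_power_card_power:
  fixes g :: "'a poly"
  shows "ac_poly g z ^ (CARD('a) ^ k) = ac_poly g (z ^ (CARD('a) ^ k))"
proof -
  have eq: "ac_poly g z = (\<Sum>i\<le>degree g. to_ac (coeff g i) * z ^ i)" for z :: "'a alg_closure"
    by (simp add: ac_poly_def poly_altdef coeff_map_poly)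
  have "(z ^ i) ^ (CARD('a) ^ k) = (z ^ (CARD('a) ^ k)) ^ i" for i
    by (metis power_mult mult.commute)
  thus ?thesis
    by (simp add: eq frobenius_sum power_mult_distrib to_ac_power_card_power)
qed

lemma power_card_power_inject:
  fixes x y :: "'a alg_closure"
  assumes "x ^ (CARD('a) ^ k) = y ^ (CARD('a) ^ k)"
  shows "x = y"
  using frobenius_diff[of x y k] assms by simp

context
  fixes P :: "'a poly" and z :: "'a alg_closure"
  assumes P: "P \<in> monic_irreds" and z: "ac_poly P z = 0"
begin

text \<open>
  The values at \<open>z\<close> of the \<open>q^m\<close> monic polynomials of degree \<open>m = degree P\<close> are distinct, since the
  difference of two of them has degree below \<open>m\<close> and is no multiple of \<open>P\<close>. If \<open>z^(q^s) = z\<close>, all these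
  values are roots of \<open>X^(q^s) - X\<close>, and this is impossible for \<open>s < m\<close>.
\<close>

lemma conjugates_no_shorter_period:
  assumes "0 < s" "s < degree P"
  shows "z ^ (CARD('a) ^ s) \<noteq> z"
proof
  assume fixed: "z ^ (CARD('a) ^ s) = z"
  have irr: "irreducible P"
    using P by (simp add: monic_irreds_def)
  let ?A = "monics (degree P) :: 'a poly set"
  let ?R = "{x :: 'a alg_closure. poly (monom 1 (CARD('a) ^ s) - monom 1 1) x = 0}"
  have q: "CARD('a) > 1"
    by (rule card_field_gt_1)
  have qs: "CARD('a) ^ s > 1"
    using q assms(1) by (rule one_less_power)
  have "coeff (monom 1 (CARD('a) ^ s) - monom 1 1 :: 'a alg_closure poly) 1 = - 1"
    using qs q assms(1) by simp
  hence nz: "monom 1 (CARD('a) ^ s) - monom 1 1 \<noteq> (0 :: 'a alg_closure poly)"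
    by (metis coeff_0 neg_equal_0_iff_equal zero_neq_one)
  have "inj_on (\<lambda>g. ac_poly g z) ?A"
  proof (rule inj_onI, rule ccontr)
    fix g h assume gh: "g \<in> ?A" "h \<in> ?A" "ac_poly g z = ac_poly h z" "g \<noteq> h"
    have "P dvd g - h"
      using gh irreducible_dvd_iff_ac_root[OF irr z, of "g - h"] by simp
    hence "degree P \<le> degree (g - h)"
      using gh(4) by (intro dvd_imp_degree_le) auto
    moreover have "degree (g - h) < degree P"
    proof (rule degree_lessI)
      show "g - h \<noteq> 0 \<or> degree P > 0"
        using degree_monic_irreds_pos[OF P] by simp
      show "\<forall>k\<ge>degree P. coeff (g - h) k = 0"
      proof (intro allI impI)
        fix k assume "k \<ge> degree P"
        thus "coeff (g - h) k = 0"
          using gh(1,2) by (cases "k = degree P") (auto simp: monics_def coeff_eq_0)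
      qed
    qed
    ultimately show False
      by simp
  qed
  hence "CARD('a) ^ degree P = card ((\<lambda>g. ac_poly g z) ` ?A)"
    by (simp add: card_image card_monics)
  also have "\<dots> \<le> card ?R"
  proof (rule card_mono)
    show "finite ?R"
      using nz by (rule poly_roots_finite)
    show "(\<lambda>g. ac_poly g z) ` ?A \<subseteq> ?R"
      using ac_poly_power_card_power[of _ z s] by (auto simp: poly_monom fixed)
  qed
  also have "\<dots> \<le> degree (monom 1 (CARD('a) ^ s) - monom 1 1 :: 'a alg_closure poly)"
    using nz by (rule card_poly_roots_bound)
  also have "\<dots> \<le> CARD('a) ^ s"
    using qs by (intro degree_diff_le order.trans[OF degree_monom_le]) auto
  finally have "degree P \<le> s"
    using q by (simp add: power_increasing_iff)
  with assms(2) show False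
    by simp
qed

lemma inj_on_conjugates: "inj_on (\<lambda>i. z ^ (CARD('a) ^ i)) {..<degree P}"
proof (rule linorder_inj_onI)
  fix i j assume ij: "i < j" "i \<in> {..<degree P}" "j \<in> {..<degree P}"
  show "z ^ (CARD('a) ^ i) \<noteq> z ^ (CARD('a) ^ j)"
  proof
    assume eq: "z ^ (CARD('a) ^ i) = z ^ (CARD('a) ^ j)"
    have "CARD('a) ^ j = CARD('a) ^ (j - i) * CARD('a) ^ i"
      using ij by (simp flip: power_add)
    hence "(z ^ (CARD('a) ^ (j - i))) ^ (CARD('a) ^ i) = z ^ (CARD('a) ^ i)"
      using eq by (simp flip: power_mult)
    hence "z ^ (CARD('a) ^ (j - i)) = z"
      by (rule power_card_power_inject)
    moreover have "0 < j - i" "j - i < degree P"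
      using ij by auto
    ultimately show False
      using conjugates_no_shorter_period by blast
  qed
qed auto

text \<open>
  The conjugates \<open>z^(q^i)\<close> with \<open>i < degree P\<close> are distinct roots of \<open>P\<close>, as many as its degree.
\<close>

lemma map_poly_eq_prod_conjugates:
  "map_poly to_ac P = (\<Prod>i<degree P. [:- (z ^ (CARD('a) ^ i)), 1:])"
proof -
  let ?P = "map_poly to_ac P"
  let ?Q = "\<Prod>i<degree P. [:- (z ^ (CARD('a) ^ i)), 1:]"
  have lcP: "lead_coeff ?P = 1"
    using P by (simp add: coeff_map_poly monic_irreds_def)
  have degQ: "degree ?Q = degree P"
    by (subst degree_prod_eq_sum_degree) auto
  have lcQ: "lead_coeff ?Q = 1"
    by (simp add: lead_coeff_prod)
  show ?thesis
  proof (rule ccontr)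
    assume neq: "?P \<noteq> ?Q"
    have root: "poly (?P - ?Q) (z ^ (CARD('a) ^ i)) = 0" if "i < degree P" for i
    proof -
      have "poly ?P (z ^ (CARD('a) ^ i)) = 0"
        using ac_poly_power_card_power[of P z i] z by (simp add: ac_poly_def power_0_left)
      moreover have "poly ?Q (z ^ (CARD('a) ^ i)) = 0"
        using that by (auto simp: poly_prod)
      ultimately show ?thesis
        by simp
    qed
    have "degree P = card ((\<lambda>i. z ^ (CARD('a) ^ i)) ` {..<degree P})"
      by (simp add: card_image inj_on_conjugates)
    also have "\<dots> \<le> card {x. poly (?P - ?Q) x = 0}"
      using neq root by (intro card_mono poly_roots_finite) auto
    also have "\<dots> \<le> degree (?P - ?Q)"
      using neq by (intro card_poly_roots_bound) simp
    also have "\<dots> < degree P"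
    proof (rule degree_lessI)
      show "?P - ?Q \<noteq> 0 \<or> degree P > 0"
        using neq by simp
      show "\<forall>k\<ge>degree P. coeff (?P - ?Q) k = 0"
      proof (intro allI impI)
        fix k assume "k \<ge> degree P"
        thus "coeff (?P - ?Q) k = 0"
          using lcP lcQ degQ by (cases "k = degree P") (auto simp: coeff_eq_0)
      qed
    qed
    finally show False
      by simp
  qed
qed

lemma conjugates_period: "z ^ (CARD('a) ^ degree P) = z"
proof -
  have "ac_poly P (z ^ (CARD('a) ^ degree P)) = 0"
    using ac_poly_power_card_power[of P z "degree P"] z by (simp add: power_0_left)
  then obtain i where i: "i < degree P" "z ^ (CARD('a) ^ degree P) = z ^ (CARD('a) ^ i)"
    by (auto simp: ac_poly_def map_poly_eq_prod_conjugates poly_prod)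
  have "CARD('a) ^ degree P = CARD('a) ^ (degree P - i) * CARD('a) ^ i"
    using i by (simp flip: power_add)
  hence "(z ^ (CARD('a) ^ (degree P - i))) ^ (CARD('a) ^ i) = z ^ (CARD('a) ^ i)"
    using i(2) by (simp flip: power_mult)
  hence *: "z ^ (CARD('a) ^ (degree P - i)) = z"
    by (rule power_card_power_inject)
  show ?thesis
  proof (cases "i = 0")
    case False
    thus ?thesis
      using * i conjugates_no_shorter_period[of "degree P - i"] by simp
  qed (use * in simp)
qed

lemma conjugates_period_mult: "z ^ (CARD('a) ^ (degree P * t)) = z"
proof (induction t)
  case (Suc t)
  have "z ^ (CARD('a) ^ (degree P * Suc t)) = (z ^ (CARD('a) ^ degree P)) ^ (CARD('a) ^ (degree P * t))"
    by (simp add: power_add flip: power_mult)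
  thus ?case
    using Suc.IH conjugates_period by simp
qed simp


text \<open>
  Over one period, \<open>i < degree P\<close>, the product of the conjugates of \<open>z - a\<close> is its norm, the value
  \<open>P(a)\<close> up to sign; the product on the left runs through \<open>t\<close> periods.
\<close>

lemma prod_conjugates_minus:
  "(\<Prod>i<degree P * t. (z - to_ac a) ^ (CARD('a) ^ i)) = ((- 1) ^ degree P * to_ac (poly P a)) ^ t"
proof (induction t)
  case (Suc t)
  let ?m = "degree P"
  have base: "(\<Prod>i<?m. (z - to_ac a) ^ (CARD('a) ^ i)) = (- 1) ^ ?m * to_ac (poly P a)"
  proof -
    have "to_ac (poly P a) = (\<Prod>i<?m. to_ac a - z ^ (CARD('a) ^ i))"
      by (simp flip: ac_poly_to_ac add: ac_poly_def map_poly_eq_prod_conjugates poly_prod)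
    also have "\<dots> = (\<Prod>i<?m. - 1 * (z - to_ac a) ^ (CARD('a) ^ i))"
      by (simp add: frobenius_diff to_ac_power_card_power)
    also have "\<dots> = (- 1) ^ ?m * (\<Prod>i<?m. (z - to_ac a) ^ (CARD('a) ^ i))"
      by (subst prod.distrib) simp
    finally show ?thesis
      by (simp flip: mult.assoc power_mult_distrib)
  qed
  have "(\<Prod>i<?m * Suc t. (z - to_ac a) ^ (CARD('a) ^ i)) =
          (\<Prod>i<?m * t. (z - to_ac a) ^ (CARD('a) ^ i)) *
          (\<Prod>i<?m. (z - to_ac a) ^ (CARD('a) ^ (?m * t + i)))"
    unfolding mult_Suc_right add.commute[of ?m] by (rule prod_lessThan_add)
  also have "(\<Prod>i<?m. (z - to_ac a) ^ (CARD('a) ^ (?m * t + i))) = (\<Prod>i<?m. (z - to_ac a) ^ (CARD('a) ^ i))"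
  proof (rule prod.cong)
    fix i
    have "(z - to_ac a) ^ (CARD('a) ^ (?m * t + i)) = ((z - to_ac a) ^ (CARD('a) ^ (?m * t))) ^ (CARD('a) ^ i)"
      by (simp add: power_add power_mult)
    also have "(z - to_ac a) ^ (CARD('a) ^ (?m * t)) = z - to_ac a"
      by (simp add: frobenius_diff to_ac_power_card_power conjugates_period_mult)
    finally show "(z - to_ac a) ^ (CARD('a) ^ (?m * t + i)) = (z - to_ac a) ^ (CARD('a) ^ i)" .
  qed simp
  finally show ?case
    using Suc.IH base by simp
qed simp

end

end

section \<open>Stepanov's auxiliary polynomial\<close>

text \<open>
  Pigeonhole principle: there are \<open>q^(card T)\<close> combinations, but only \<open>q^E\<close> polynomials of degree below
  \<open>E\<close>. Adding \<open>X^E\<close> turns the latter into the monic polynomials of degree \<open>E\<close>, which are already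
  counted.
\<close>

lemma exists_linear_dependency:
  fixes v :: "'i \<Rightarrow> 'a::{field,finite} poly"
  assumes T: "finite T" and deg: "\<And>t. t \<in> T \<Longrightarrow> degree (v t) < E" and card: "E < card T"
  obtains c where "\<exists>t\<in>T. c t \<noteq> 0" "(\<Sum>t\<in>T. smult (c t) (v t)) = 0"
proof -
  define \<Phi> where "\<Phi> = (\<lambda>c. \<Sum>t\<in>T. smult (c t) (v t))"
  let ?X = "PiE T (\<lambda>_. UNIV :: 'a set)"
  have "E > 0"
    using card deg by (metis card_gt_0_iff ex_in_conv gr_zeroI less_nat_zero_code not_less0)
  have "degree (\<Phi> c) < E" for c
    unfolding \<Phi>_def using deg \<open>E > 0\<close>
    by (intro degree_sum_less) (auto intro: le_less_trans[OF degree_smult_le])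
  hence "\<Phi> c + monom 1 E \<in> monics E" for c
  proof -
    assume *: "\<And>c. degree (\<Phi> c) < E"
    have "degree (\<Phi> c + monom 1 E) = E"
      using *[of c] by (subst degree_add_eq_right) (auto simp: degree_monom_eq)
    thus ?thesis
      using *[of c] by (simp add: monics_def coeff_eq_0)
  qed
  hence sub: "(\<lambda>c. \<Phi> c + monom 1 E) ` ?X \<subseteq> monics E"
    by blast
  have "\<not> inj_on (\<lambda>c. \<Phi> c + monom 1 E) ?X"
  proof
    assume inj: "inj_on (\<lambda>c. \<Phi> c + monom 1 E) ?X"
    have "CARD('a) ^ card T = card ?X"
      using T by (simp add: card_PiE)
    also have "\<dots> \<le> card (monics E :: 'a poly set)"
      using inj sub by (rule card_inj_on_le) simp
    also have "\<dots> = CARD('a) ^ E"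
      by (rule card_monics)
    finally have "CARD('a) ^ card T \<le> CARD('a) ^ E" .
    moreover have "CARD('a) > 1"
      by (rule card_field_gt_1)
    ultimately have "card T \<le> E"
      by (rule power_le_imp_le_exp[rotated])
    with card show False
      by simp
  qed
  then obtain c1 c2 where c: "c1 \<in> ?X" "c2 \<in> ?X" "c1 \<noteq> c2" "\<Phi> c1 = \<Phi> c2"
    by (auto simp: inj_on_def)
  show ?thesis
  proof (rule that[of "\<lambda>t. c1 t - c2 t"])
    show "\<exists>t\<in>T. c1 t - c2 t \<noteq> 0"
      using c(1-3) by (metis PiE_ext right_minus_eq)
    show "(\<Sum>t\<in>T. smult (c1 t - c2 t) (v t)) = 0"
      using c(4) by (simp add: \<Phi>_def smult_diff_left sum_subtractf)
  qed
qed

lemma sum_neq_0_if_distinct_degrees: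
  fixes w :: "'i \<Rightarrow> 'a::field poly"
  assumes T: "finite T" and inj: "inj_on (\<lambda>t. degree (w t)) T"
    and nz: "\<And>t. t \<in> T \<Longrightarrow> w t \<noteq> 0" and c: "\<exists>t\<in>T. c t \<noteq> 0"
  shows "(\<Sum>t\<in>T. smult (c t) (w t)) \<noteq> 0"
proof
  assume 0: "(\<Sum>t\<in>T. smult (c t) (w t)) = 0"
  let ?T = "{t \<in> T. c t \<noteq> 0}"
  let ?m = "Max ((\<lambda>t. degree (w t)) ` ?T)"
  have "?m \<in> (\<lambda>t. degree (w t)) ` ?T"
    using T c by (intro Max_in) auto
  then obtain t0 where t0: "t0 \<in> ?T" "degree (w t0) = ?m"
    by auto
  have max: "degree (w t) \<le> degree (w t0)" if "t \<in> ?T" for t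
    unfolding t0(2) using T that by (intro Max_ge) auto
  have "0 = coeff (\<Sum>t\<in>T. smult (c t) (w t)) (degree (w t0))"
    using 0 by simp
  also have "\<dots> = (\<Sum>t\<in>T. c t * coeff (w t) (degree (w t0)))"
    by (simp add: coeff_sum)
  also have "\<dots> = (\<Sum>t\<in>{t0}. c t * coeff (w t) (degree (w t0)))"
  proof (rule sum.mono_neutral_right)
    show "\<forall>t\<in>T - {t0}. c t * coeff (w t) (degree (w t0)) = 0"
    proof
      fix t assume t: "t \<in> T - {t0}"
      show "c t * coeff (w t) (degree (w t0)) = 0"
      proof (cases "c t = 0")
        case False
        hence "degree (w t) \<le> degree (w t0)"
          using t max by simp
        moreover have "degree (w t) \<noteq> degree (w t0)"
          using t t0(1) inj by (auto dest: inj_onD)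
        ultimately show ?thesis
          by (simp add: coeff_eq_0)
      qed simp
    qed
  qed (use T t0 in auto)
  finally show False
    using t0(1) nz by auto
qed

context
  fixes p e :: nat
  assumes prime_p: "prime p" and card_eq: "CARD('a::{field,finite}) = p ^ e"
begin

text \<open>
  Write \<open>R = q^k = 2 s + 1\<close>, \<open>Q = R^2\<close> and \<open>f = \<Prod>a\<in>A. X - a\<close>, of odd degree \<open>d = 2 l + 1\<close>. The points of
  interest are the \<open>z\<close> in the field with \<open>Q\<close> elements such that \<open>f(z)^((Q-1)/2) = \<epsilon>\<close>; for \<open>\<epsilon> = 1\<close> and
  \<open>\<epsilon> = -1\<close> these are the abscissae of the points of \<open>y^2 = f(x)\<close> and of its quadratic twist. The aim is
  a nonzero \<open>G\<close> vanishing at all of them whose degree is only \<open>Q/2 + O(R)\<close>.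

  Take \<open>G\<close> to be a combination, with coefficients in the base field, of the polynomials
  \<open>X^(i + R j)\<close> and \<open>f^((R+1)/2) X^(i + R j)\<close>. At the points of interest \<open>z^Q = z\<close> and
  \<open>f(z)^(R (R+1)/2) = \<epsilon> f(z)^((R+1)/2)\<close>, because \<open>R (R+1)/2 = (Q-1)/2 + (R+1)/2\<close>. The \<open>R\<close>-th powers
  of these polynomials therefore take the same values there as \<open>X^(R i + j)\<close> and
  \<open>\<epsilon> f^((R+1)/2) X^(R i + j)\<close>. With \<open>2 i < R\<close> in the first family, \<open>2 i + d < R\<close> in the second, and
  \<open>j < s + l + 1\<close>, which is about \<open>(R + d) / 2\<close>, there are more of the latter polynomials than the
  dimension of the space in which their degrees confine them. Hence they satisfy a nontrivial linear
  relation, and the combination \<open>G\<close> with the same coefficients satisfies \<open>G(z)^R = 0\<close>.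

  That \<open>G\<close> is not zero is where the odd degree of \<open>f\<close> enters: twice the degrees of the two families
  are \<open>2 i + R (2 j)\<close> and \<open>(2 i + d) + R (2 j + d)\<close>, and since the first summands are below \<open>R\<close> and the
  cofactors of \<open>R\<close> are even in one family and odd in the other, all the degrees are different.
\<close>

lemma Stepanov_auxiliary_polynomial:
  fixes A :: "'a set" and \<epsilon> :: 'a
  assumes d: "card A = 2 * l + 1" and r: "CARD('a) ^ k = 2 * s + 1" and "l < s"
  obtains G where "G \<noteq> 0" "2 * degree G \<le> (2 * s + 1)\<^sup>2 + 3 * card A * (2 * s + 1)"
    "\<forall>z. z ^ (CARD('a) ^ (2 * k)) = z \<and>
       (\<Prod>a\<in>A. z - to_ac a) ^ ((CARD('a) ^ (2 * k) - 1) div 2) = to_ac \<epsilon> \<longrightarrow> ac_poly G z = 0"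
proof -
  (* The largest i in the second family; it is the largest one with 2 i + d < R. *)
  define x where "x = s - l - 1"
  have s: "s = l + 1 + x"
    using \<open>l < s\<close> by (simp add: x_def)
  define R where "R = 2 * s + 1"
  define n where "n = s + l + 1"
  define f where "f = (\<Prod>a\<in>A. [:- a, 1:])"
  define H where "H = f ^ (s + 1)"
  (* The Boolean component of an index tells whether the factor f^((R+1)/2) is present. *)
  define w where "w = (\<lambda>(b, i, j). (if b then H else 1) * monom 1 (i + R * j))"
  define v where "v = (\<lambda>(b, i, j). (if b then smult \<epsilon> H else 1) * monom 1 (R * i + j))"
  define T where "T = {False} \<times> ({..s} \<times> {..<n}) \<union> {True} \<times> ({..x} \<times> {..<n})"
  define E where "E = R * s + n"
  have T: "finite T"
    by (simp add: T_def)
  have "f \<noteq> 0"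
    by (simp add: f_def)
  hence "H \<noteq> 0"
    by (simp add: H_def)
  have "degree f = card A"
    unfolding f_def by (subst degree_prod_eq_sum_degree) auto
  moreover have "degree H = (s + 1) * degree f"
    unfolding H_def using \<open>f \<noteq> 0\<close> by (rule degree_power_eq)
  ultimately have deg_H: "degree H = (2 * l + 1) * (s + 1)"
    by (simp add: d)
  have deg_w: "degree (w (b, i, j)) = (if b then (2 * l + 1) * (s + 1) else 0) + i + R * j" for b i j
    using \<open>H \<noteq> 0\<close> by (simp add: w_def degree_mult_eq deg_H degree_monom_eq)
  have deg_v: "degree (v t) < E" if "t \<in> T" for t
  proof -
    obtain b i j where t: "t = (b, i, j)"
      by (cases t)
    show ?thesis
    proof (cases b)
      case False
      hence "degree (v t) = R * i + j"
        by (simp add: t v_def degree_monom_eq)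
      moreover have "i \<le> s" "j < n"
        using that False by (auto simp: t T_def)
      hence "R * i + j < R * s + n"
        by (intro add_le_less_mono mult_le_mono2)
      ultimately show ?thesis
        by (simp add: E_def)
    next
      case True
      hence "v t = smult \<epsilon> H * monom 1 (R * i + j)"
        by (simp add: t v_def)
      hence "degree (v t) \<le> degree (smult \<epsilon> H) + degree (monom 1 (R * i + j) :: 'a poly)"
        by (simp only: degree_mult_le)
      also have "\<dots> \<le> (2 * l + 1) * (s + 1) + (R * i + j)"
        using degree_smult_le[of \<epsilon> H] by (simp add: degree_monom_eq deg_H)
      also have "\<dots> < (2 * l + 1) * (s + 1) + (R * x + n)"
      proof -
        have "i \<le> x" "j < n"
          using that True by (auto simp: t T_def)
        hence "R * i + j < R * x + n"
          by (intro add_le_less_mono mult_le_mono2)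
        thus ?thesis
          by simp
      qed
      also have "\<dots> \<le> E"
        by (simp add: E_def R_def s algebra_simps)
      finally show ?thesis .
    qed
  qed
  have card_T: "card T = (s + 1) * n + (x + 1) * n"
    unfolding T_def by (subst card_Un_disjoint) (auto simp: card_cartesian_product)
  have E_less: "E < card T"
    unfolding card_T by (simp add: E_def R_def n_def s algebra_simps)
  obtain c where c: "\<exists>t\<in>T. c t \<noteq> 0" "(\<Sum>t\<in>T. smult (c t) (v t)) = 0"
    by (rule exists_linear_dependency[OF T deg_v E_less])
  define G where "G = (\<Sum>t\<in>T. smult (c t) (w t))"
  have inj: "inj_on (\<lambda>t. degree (w t)) T"
  proof -
    have repr: "(2 * degree (w (b, i, j))) div R = 2 * j + (if b then 2 * l + 1 else 0)"
      "(2 * degree (w (b, i, j))) mod R = 2 * i + (if b then 2 * l + 1 else 0)"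
      if "(b, i, j) \<in> T" for b i j
    proof -
      let ?u = "2 * i + (if b then 2 * l + 1 else 0)" and ?g = "2 * j + (if b then 2 * l + 1 else 0)"
      have "?u < R"
        using that by (auto simp: T_def R_def s)
      moreover have "2 * degree (w (b, i, j)) = ?u + R * ?g"
        by (simp add: deg_w R_def algebra_simps)
      ultimately show "(2 * degree (w (b, i, j))) div R = ?g" "(2 * degree (w (b, i, j))) mod R = ?u"
        by simp_all
    qed
    show ?thesis
    proof (rule inj_onI)
      fix t t' assume t: "t \<in> T" "t' \<in> T" and eq: "degree (w t) = degree (w t')"
      obtain b i j b' i' j' where [simp]: "t = (b, i, j)" "t' = (b', i', j')"
        by (cases t, cases t')
      have j: "2 * j + (if b then 2 * l + 1 else 0) = 2 * j' + (if b' then 2 * l + 1 else 0)"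
        and i: "2 * i + (if b then 2 * l + 1 else 0) = 2 * i' + (if b' then 2 * l + 1 else 0)"
        using repr[of b i j] repr[of b' i' j'] t eq by auto
      from j have "b = b'"
        by (cases b; cases b'; simp; presburger)
      with i j show "t = t'"
        by simp
    qed
  qed
  have "G \<noteq> 0"
    unfolding G_def using T inj _ c(1)
  proof (rule sum_neq_0_if_distinct_degrees)
    show "w t \<noteq> 0" for t
      using \<open>H \<noteq> 0\<close> by (cases t) (simp add: w_def)
  qed
  moreover have "2 * degree G \<le> (2 * s + 1)\<^sup>2 + 3 * card A * (2 * s + 1)"
  proof -
    define M where "M = (2 * l + 1) * (s + 1) + s + R * (s + l)"
    have "degree (w t) \<le> M" if "t \<in> T" for t
    proof -
      obtain b i j where t: "t = (b, i, j)"
        by (cases t)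
      have "i \<le> s" "j \<le> s + l"
        using that by (auto simp: t T_def n_def s)
      hence "i + R * j \<le> s + R * (s + l)"
        by (intro add_le_mono mult_le_mono2)
      thus ?thesis
        by (simp add: t deg_w M_def)
    qed
    hence "degree G \<le> M"
      unfolding G_def by (intro degree_sum_le T) (auto intro: order.trans[OF degree_smult_le])
    moreover have "2 * M \<le> (2 * s + 1)\<^sup>2 + 3 * card A * (2 * s + 1)"
      by (simp add: M_def R_def d algebra_simps power2_eq_square)
    ultimately show ?thesis
      by linarith
  qed
  moreover have "ac_poly G z = 0"
    if z: "z ^ (CARD('a) ^ (2 * k)) = z"
      and fz: "(\<Prod>a\<in>A. z - to_ac a) ^ ((CARD('a) ^ (2 * k) - 1) div 2) = to_ac \<epsilon>" for z
  proof -
    have Q: "CARD('a) ^ (2 * k) = R * R"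
      by (simp add: mult_2 power_add r R_def)
    have Q2: "(CARD('a) ^ (2 * k) - 1) div 2 = 2 * s * (s + 1)"
      unfolding Q R_def by (simp add: algebra_simps)
    have z': "z ^ (R * R) = z"
      using z by (simp only: Q)
    define y where "y = ac_poly f z"
    have "y = (\<Prod>a\<in>A. z - to_ac a)"
      by (simp add: y_def f_def ac_poly_prod)
    hence y: "y ^ (2 * s * (s + 1)) = to_ac \<epsilon>"
      using fz by (simp only: Q2)
    have yH: "ac_poly H z = y ^ (s + 1)"
      by (simp add: H_def y_def)
    have H_pow: "ac_poly H z ^ R = to_ac \<epsilon> * ac_poly H z"
    proof -
      have "(s + 1) * R = 2 * s * (s + 1) + (s + 1)"
        by (simp add: R_def algebra_simps)
      hence "ac_poly H z ^ R = y ^ (2 * s * (s + 1) + (s + 1))"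
        by (simp only: yH flip: power_mult)
      thus ?thesis
        by (simp only: power_add y yH)
    qed
    have mon: "(z ^ (i + R * j)) ^ R = z ^ (R * i + j)" for i j
    proof -
      have "(z ^ (i + R * j)) ^ R = z ^ (R * i + R * R * j)"
        by (simp add: algebra_simps flip: power_mult)
      also have "\<dots> = z ^ (R * i) * (z ^ (R * R)) ^ j"
        by (simp only: power_add power_mult)
      finally show ?thesis
        by (simp only: z' power_add)
    qed
    have wv: "ac_poly (w t) z ^ R = ac_poly (v t) z" for t
      by (cases t) (simp add: w_def v_def power_mult_distrib mon H_pow)
    have "ac_poly G z ^ R = (\<Sum>t\<in>T. (to_ac (c t) * ac_poly (w t) z) ^ (CARD('a) ^ k))"
      unfolding G_def ac_poly_sum ac_poly_smult
      by (subst frobenius_sum[OF prime_p card_eq, symmetric]) (simp only: r R_def)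
    also have "\<dots> = (\<Sum>t\<in>T. to_ac (c t) * ac_poly (v t) z)"
      using wv by (simp add: power_mult_distrib to_ac_power_card_power[OF prime_p card_eq])
        (simp only: r R_def)
    also have "\<dots> = ac_poly (\<Sum>t\<in>T. smult (c t) (v t)) z"
      by (simp add: ac_poly_sum)
    finally show ?thesis
      by (simp add: c(2))
  qed
  ultimately show ?thesis
    by (intro that[of G]) auto
qed

end

section \<open>The bound for character sums\<close>

lemma sum_degree_le_if_irreds_dvd:
  fixes G :: "'a::field poly"
  assumes "finite I" "I \<subseteq> monic_irreds" "G \<noteq> 0" "\<And>P. P \<in> I \<Longrightarrow> P dvd G"
  shows "(\<Sum>P\<in>I. degree P) \<le> degree G"
  using assms
proof (induction I arbitrary: G rule: finite_induct)
  case (insert P I)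
  obtain H where G: "G = P * H"
    using insert.prems(3)[of P] by (auto elim: dvdE)
  have "P \<noteq> 0" "H \<noteq> 0"
    using insert.prems(2) G by auto
  have "Q dvd H" if "Q \<in> I" for Q
  proof -
    have "P \<in> monic_irreds" "Q \<in> monic_irreds" "P \<noteq> Q"
      using insert.prems(1) insert.hyps(2) that by auto
    from irred_power_dvd_mult_other[OF this, of 1 H] insert.prems(3)[of Q] that show ?thesis
      by (simp add: G)
  qed
  with insert.IH[of H] insert.prems \<open>H \<noteq> 0\<close> have "(\<Sum>P\<in>I. degree P) \<le> degree H"
    by simp
  thus ?case
    using insert.hyps \<open>P \<noteq> 0\<close> \<open>H \<noteq> 0\<close> by (simp add: G degree_mult_eq)
qed simp

text \<open>
  For a monic irreducible \<open>P\<close> this is, up to sign, the quadratic residue symbol of \<open>\<Prod>a\<in>A. X - a\<close> modulo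
  \<open>P\<close>; the lemma \<open>power_residue_at_root\<close> below is the reciprocity law behind this. In the present form
  the symbol is defined for all \<open>g\<close>, is multiplicative, and depends only on the values of \<open>g\<close> on \<open>A\<close>.
\<close>

definition poly_character :: "'a::{field,finite} set \<Rightarrow> 'a poly \<Rightarrow> real" where
  "poly_character A g = (\<Prod>a\<in>A. quad_char (poly g a))"

lemma geometric_sum_nat:
  fixes q :: nat
  assumes "q \<ge> 1"
  shows "(q - 1) * (\<Sum>i<n. q ^ i) = q ^ n - 1"
proof -
  have "int ((q - 1) * (\<Sum>i<n. q ^ i)) = int (q ^ n - 1)"
    using assms power_diff_1_eq[of "int q" n] by (simp add: of_nat_diff)
  thus ?thesis
    by (simp only: of_nat_eq_iff)
qed

lemma prime_power_sum_1:
  "prime_power_sum \<psi> 1 = (\<Sum>x\<in>(UNIV :: 'a::{field,finite} set). \<psi> [:- x, 1:])"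
proof -
  have "{P :: 'a poly. P \<in> monic_irreds \<and> degree P dvd 1} = (\<lambda>x. [:- x, 1:]) ` UNIV"
  proof (intro subset_antisym subsetI)
    fix P :: "'a poly" assume "P \<in> {P. P \<in> monic_irreds \<and> degree P dvd 1}"
    hence "P \<in> monic_irreds" "degree P = Suc 0"
      by auto
    hence P: "P \<in> monics (Suc 0)"
      using monic_irreds_monics[of P] by simp
    then obtain a where "P = pCons a 1"
      unfolding monics_Suc monics_0 by auto
    hence "P = [:- (- a), 1:]"
      by (simp add: one_pCons)
    thus "P \<in> (\<lambda>x. [:- x, 1:]) ` UNIV"
      by blast
  qed (auto simp: monic_irreds_def intro!: irreducible_linear_field_poly)
  moreover have "inj (\<lambda>x :: 'a. [:- x, 1:])"
    by (auto simp: inj_def)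
  ultimately show ?thesis
    by (simp add: prime_power_sum_def sum.reindex)
qed

context
  fixes p e :: nat
  assumes prime_p: "prime p" and card_eq: "CARD('a::{field,finite}) = p ^ e"
    and odd_card: "odd CARD('a)"
begin

text \<open>
  The exponent \<open>(q^(2 k) - 1) / 2\<close> is \<open>1 + q + \<dots> + q^(2 k - 1)\<close> times \<open>(q - 1) / 2\<close>. Raising \<open>z - a\<close> to the
  first factor gives a power of its norm \<open>P(a)\<close>, with the signs cancelling because \<open>2 k\<close> is even;
  raising to the second factor is the quadratic character, by Euler's criterion.
\<close>

lemma power_residue_at_root:
  fixes A :: "'a set"
  assumes P: "P \<in> monic_irreds" and z: "ac_poly P z = 0" and dvd: "degree P dvd 2 * k"
  shows "(\<Prod>a\<in>A. z - to_ac a) ^ ((CARD('a) ^ (2 * k) - 1) div 2) =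
           to_ac (((\<Prod>a\<in>A. poly P a) ^ (2 * k div degree P)) ^ ((CARD('a) - 1) div 2))"
proof -
  define t where "t = 2 * k div degree P"
  have mt: "degree P * t = 2 * k"
    using dvd by (simp add: t_def)
  define h where "h = (CARD('a) - 1) div 2"
  have h: "CARD('a) - 1 = 2 * h"
    using odd_card by (simp add: h_def even_Suc_div_two)
  have "CARD('a) ^ (2 * k) - 1 = (CARD('a) - 1) * (\<Sum>i<2*k. CARD('a) ^ i)"
    using zero_less_card_finite[where ?'a = 'a]
    by (intro geometric_sum_nat[symmetric]) linarith
  hence "CARD('a) ^ (2 * k) - 1 = 2 * ((\<Sum>i<2*k. CARD('a) ^ i) * h)"
    by (simp only: h ac_simps)
  hence exponent: "(CARD('a) ^ (2 * k) - 1) div 2 = (\<Sum>i<2*k. CARD('a) ^ i) * h"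
    by simp
  have "(\<Prod>a\<in>A. z - to_ac a) ^ (\<Sum>i<2*k. CARD('a) ^ i) =
          (\<Prod>a\<in>A. \<Prod>i<2*k. (z - to_ac a) ^ (CARD('a) ^ i))"
    by (simp add: prod_power_distrib power_sum) (rule prod.swap)
  also have "\<dots> = (\<Prod>a\<in>A. ((- 1) ^ degree P * to_ac (poly P a)) ^ t)"
    unfolding mt[symmetric] by (intro prod.cong refl prod_conjugates_minus[OF prime_p card_eq P z])
  also have "\<dots> = (\<Prod>a\<in>A. to_ac (poly P a) ^ t)"
  proof (intro prod.cong refl)
    fix a
    have "((- 1 :: 'a alg_closure) ^ degree P) ^ t = (- 1) ^ (2 * k)"
      by (simp only: mt flip: power_mult)
    thus "((- 1) ^ degree P * to_ac (poly P a)) ^ t = to_ac (poly P a) ^ t"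
      by (simp add: power_mult_distrib)
  qed
  also have "\<dots> = to_ac ((\<Prod>a\<in>A. poly P a) ^ t)"
    by (simp add: to_ac_prod prod_power_distrib)
  finally have "((\<Prod>a\<in>A. z - to_ac a) ^ (\<Sum>i<2*k. CARD('a) ^ i)) ^ h =
          to_ac (((\<Prod>a\<in>A. poly P a) ^ t) ^ h)"
    by simp
  thus ?thesis
    unfolding exponent power_mult[of _ "\<Sum>i<2*k. CARD('a) ^ i"] t_def h_def .
qed

lemma poly_character_power:
  "poly_character A g ^ t = quad_char ((\<Prod>a\<in>A. poly g a) ^ t :: 'a)"
  by (simp add: poly_character_def quad_char_power[OF odd_card] quad_char_prod[OF odd_card])

text \<open>
  A root of such a polynomial \<open>P\<close> is one of the points at which Stepanov's polynomial \<open>G\<close> vanishes.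
  Hence all these \<open>P\<close> divide \<open>G\<close>, and the sum of their degrees is at most the degree of \<open>G\<close>.
\<close>

lemma sum_degree_fixed_character_le:
  fixes A :: "'a set"
  assumes d: "odd (card A)" and k: "k > 0" "CARD('a) ^ k > card A" and eps: "\<epsilon> = 1 \<or> \<epsilon> = - 1"
  shows "2 * (\<Sum>P\<in>{P \<in> monic_irreds. degree P dvd 2 * k \<and>
                   poly_character A P ^ (2 * k div degree P) = \<epsilon>}. degree P) \<le>
           (CARD('a) ^ k)\<^sup>2 + 3 * card A * CARD('a) ^ k"
proof -
  let ?I = "{P \<in> monic_irreds. degree P dvd 2 * k \<and>
               poly_character A P ^ (2 * k div degree P) = \<epsilon>}"
  define \<epsilon>' :: 'a where "\<epsilon>' = (if \<epsilon> = 1 then 1 else - 1)"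
  obtain l where l: "card A = 2 * l + 1"
    using d by (elim oddE)
  have "odd (CARD('a) ^ k)"
    using odd_card by simp
  then obtain s where s: "CARD('a) ^ k = 2 * s + 1"
    by (elim oddE)
  have "l < s"
    using k l s by simp
  obtain G where G: "G \<noteq> 0" "2 * degree G \<le> (2 * s + 1)\<^sup>2 + 3 * card A * (2 * s + 1)"
    "\<forall>z. z ^ (CARD('a) ^ (2 * k)) = z \<and>
       (\<Prod>a\<in>A. z - to_ac a) ^ ((CARD('a) ^ (2 * k) - 1) div 2) = to_ac \<epsilon>' \<longrightarrow> ac_poly G z = 0"
    by (rule Stepanov_auxiliary_polynomial[OF prime_p card_eq l s \<open>l < s\<close>, of \<epsilon>'])
  have "(\<Sum>P\<in>?I. degree P) \<le> degree G"
  proof (rule sum_degree_le_if_irreds_dvd)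
    show "finite ?I"
      by (rule finite_subset[OF _ finite_irreds_degree_dvd[of "2 * k"]]) (use k in auto)
    show "P dvd G" if P: "P \<in> ?I" for P
    proof -
      obtain z where z: "ac_poly P z = 0"
        using exists_ac_root[of P] degree_monic_irreds_pos[of P] P by blast
      have irr: "P \<in> monic_irreds" and dvd: "degree P dvd 2 * k"
        using P by auto
      have "2 * k = degree P * (2 * k div degree P)"
        using dvd by simp
      hence "z ^ (CARD('a) ^ (2 * k)) = z"
        using conjugates_period_mult[OF prime_p card_eq irr z, of "2 * k div degree P"] by simp
      moreover have "quad_char ((\<Prod>a\<in>A. poly P a) ^ (2 * k div degree P)) = \<epsilon>"
        using P by (simp add: poly_character_power)
      hence "((\<Prod>a\<in>A. poly P a) ^ (2 * k div degree P)) ^ ((CARD('a) - 1) div 2) = \<epsilon>'"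
        using eps Euler_criterion_quad_char[OF odd_card, of "(\<Prod>a\<in>A. poly P a) ^ (2 * k div degree P)"]
        by (auto simp: \<epsilon>'_def)
      ultimately have "ac_poly G z = 0"
        using G(3) power_residue_at_root[OF irr z dvd, of A] by metis
      thus ?thesis
        using irreducible_dvd_iff_ac_root[OF _ z] irr by (simp add: monic_irreds_def)
    qed
  qed (use G in auto)
  thus ?thesis
    using G(2) unfolding s by linarith
qed

lemma sum_degree_zero_character_le:
  fixes A :: "'a set"
  shows "(\<Sum>P\<in>{P \<in> monic_irreds. degree P dvd k \<and>
             poly_character A P ^ (k div degree P) = 0}. degree P) \<le> card A"
proof -
  let ?I = "{P \<in> monic_irreds. degree P dvd k \<and> poly_character A P ^ (k div degree P) = 0}"
  have "?I \<subseteq> (\<lambda>a. [:- a, 1:]) ` A"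
  proof
    fix P assume P: "P \<in> ?I"
    hence "poly_character A P = 0"
      by (auto simp: power_0_left split: if_splits)
    then obtain a where a: "a \<in> A" "poly P a = 0"
      by (auto simp: poly_character_def)
    hence "[:- a, 1:] dvd P"
      by (simp add: poly_eq_0_iff_dvd)
    moreover have "[:- a, 1:] \<in> monic_irreds"
      by (auto simp: monic_irreds_def intro!: irreducible_linear_field_poly)
    ultimately have "P = [:- a, 1:]"
      using P monic_irreds_dvd_imp_eq by blast
    with a show "P \<in> (\<lambda>a. [:- a, 1:]) ` A"
      by blast
  qed
  hence "(\<Sum>P\<in>?I. degree P) \<le> (\<Sum>P\<in>(\<lambda>a. [:- a, 1:]) ` A. degree P)"
    by (intro sum_mono2) auto
  also have "\<dots> = (\<Sum>P\<in>(\<lambda>a. [:- a, 1:]) ` A. 1)"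
    by (intro sum.cong) auto
  also have "\<dots> \<le> card A"
    by (simp add: card_image_le)
  finally show ?thesis .
qed

text \<open>
  Stepanov's method gives upper bounds for the number of points with character value \<open>1\<close> and for the
  number with value \<open>- 1\<close>. As the two numbers add up to \<open>q^(2 k)\<close>, except for the few zeros of
  \<open>\<Prod>a\<in>A. X - a\<close>, each upper bound is a lower bound for the other number, and their difference is
  small.
\<close>

lemma prime_power_sum_even_bound:
  fixes A :: "'a set"
  assumes d: "odd (card A)" and k: "k > 0" "CARD('a) ^ k > card A"
  shows "\<bar>prime_power_sum (poly_character A) (2 * k)\<bar> \<le> 4 * real (card A) * real CARD('a) ^ k"
proof -
  let ?I = "{P :: 'a poly. P \<in> monic_irreds \<and> degree P dvd 2 * k}"
  let ?x = "\<lambda>P. poly_character A P ^ (2 * k div degree P)"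
  define N where "N = (\<lambda>y :: real. \<Sum>P\<in>{P \<in> ?I. ?x P = y}. degree P)"
  have fin: "finite ?I"
    using k by simp
  have x: "?x P = 0 \<or> ?x P = 1 \<or> ?x P = - 1" for P
    using quad_char_cases[of "(\<Prod>a\<in>A. poly P a) ^ (2 * k div degree P)"]
    by (simp only: poly_character_power)
  have N: "real (N y) = (\<Sum>P\<in>?I. real (degree P) * (if ?x P = y then 1 else 0))" for y
  proof -
    have "real (N y) = (\<Sum>P\<in>{P \<in> ?I. ?x P = y}. real (degree P))"
      by (simp add: N_def)
    also have "\<dots> = (\<Sum>P\<in>?I. if ?x P = y then real (degree P) else 0)"
      using fin by (rule sum.inter_filter)
    also have "\<dots> = (\<Sum>P\<in>?I. real (degree P) * (if ?x P = y then 1 else 0))"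
      by (intro sum.cong) auto
    finally show ?thesis .
  qed
  have total: "(\<Sum>P\<in>?I. real (degree P)) = real CARD('a) ^ (2 * k)"
    using k by (intro sum_degree_monic_irreds) simp
  have S: "\<sigma> * prime_power_sum (poly_character A) (2 * k) =
             2 * real (N \<sigma>) - real CARD('a) ^ (2 * k) + real (N 0)"
    if "\<sigma> = 1 \<or> \<sigma> = - 1" for \<sigma>
  proof -
    have "\<sigma> * prime_power_sum (poly_character A) (2 * k) =
      (\<Sum>P\<in>?I. 2 * (real (degree P) * (if ?x P = \<sigma> then 1 else 0)) - real (degree P)
                + real (degree P) * (if ?x P = 0 then 1 else 0))"
      unfolding prime_power_sum_def sum_distrib_left
    proof (intro sum.cong refl)
      fix P
      have "\<sigma> * (D * y) = 2 * (D * (if y = \<sigma> then 1 else 0)) - D + D * (if y = 0 then 1 else 0)"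
        if "y = 0 \<or> y = 1 \<or> y = - 1" for y D :: real
        using that \<open>\<sigma> = 1 \<or> \<sigma> = - 1\<close> by (elim disjE) simp_all
      from this[OF x[of P]] show "\<sigma> * (real (degree P) * ?x P) =
        2 * (real (degree P) * (if ?x P = \<sigma> then 1 else 0)) - real (degree P)
                + real (degree P) * (if ?x P = 0 then 1 else 0)" .
    qed
    also have "\<dots> = 2 * real (N \<sigma>) - real CARD('a) ^ (2 * k) + real (N 0)"
      by (simp only: sum.distrib sum_subtractf N total flip: sum_distrib_left)
    finally show ?thesis .
  qed
  have "2 * N \<sigma> \<le> (CARD('a) ^ k)\<^sup>2 + 3 * card A * CARD('a) ^ k" if "\<sigma> = 1 \<or> \<sigma> = - 1" for \<sigma>
    using sum_degree_fixed_character_le[OF d k that] by (simp add: N_def conj_assoc)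
  hence N_le: "2 * real (N \<sigma>) \<le> (real CARD('a) ^ k)\<^sup>2 + 3 * real (card A) * real CARD('a) ^ k"
    if "\<sigma> = 1 \<or> \<sigma> = - 1" for \<sigma>
    using that by (metis (mono_tags, lifting) of_nat_add of_nat_le_iff of_nat_mult of_nat_numeral of_nat_power)
  have "N 0 \<le> card A"
    using sum_degree_zero_character_le[of "2 * k" A] by (simp add: N_def conj_assoc)
  hence N0: "real (N 0) \<le> real (card A)"
    by simp
  also have "\<dots> \<le> real (card A) * real CARD('a) ^ k"
    using mult_left_mono[OF one_le_power[of "real CARD('a)" k], of "real (card A)"]
      card_field_gt_1[where ?'a = 'a] by simp
  finally have N0': "real (N 0) \<le> real (card A) * real CARD('a) ^ k" .
  have "\<sigma> * prime_power_sum (poly_character A) (2 * k) \<le> 4 * real (card A) * real CARD('a) ^ k"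
    if "\<sigma> = 1 \<or> \<sigma> = - 1" for \<sigma>
    using S[OF that] N_le[OF that] N0' by (simp add: power_mult mult.commute[of 2 k])
  from this[of 1] this[of "- 1"] show ?thesis
    by simp
qed

text \<open>
  The coefficients of the L-function vanish from degree \<open>card A\<close> on. By Lagrange interpolation,
  multiplying the value at one point \<open>a0\<close> of \<open>A\<close> by a nonsquare \<open>c\<close>, with the values at the other points
  unchanged, is possible within the monic polynomials of degree \<open>m\<close>. It permutes them and reverses the
  sign of the character.
\<close>

lemma sum_monics_poly_character_eq_0:
  fixes A :: "'a set"
  assumes A: "A \<noteq> {}" and m: "m \<ge> card A"
  shows "(\<Sum>g\<in>monics m. poly_character A g) = 0"
proof -
  obtain a0 where a0: "a0 \<in> A"
    using A by blast
  obtain c :: 'a where c: "quad_char c = - 1"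
    using exists_nonsquare[OF odd_card] by blast
  have "c \<noteq> 0"
    using c by auto
  define B where "B = (\<Prod>a\<in>A - {a0}. [:- a, 1:])"
  define L where "L = smult (inverse (poly B a0)) B"
  have B0: "poly B a0 \<noteq> 0"
    by (auto simp: B_def poly_prod)
  have L: "poly L a = (if a = a0 then 1 else 0)" if "a \<in> A" for a
    using that B0 by (auto simp: L_def) (auto simp: B_def poly_prod)
  have "degree B = card (A - {a0})"
    unfolding B_def by (subst degree_prod_eq_sum_degree) auto
  also have "\<dots> < m"
    using a0 m card_Diff1_less[of A a0] by (simp add: card_gt_0_iff)
  finally have degL: "degree (smult b L) < m" for b
    by (intro le_less_trans[OF degree_smult_le]) (auto simp: L_def intro: le_less_trans[OF degree_smult_le])
  define T where "T = (\<lambda>c g. g + smult ((c - 1) * poly g a0) L)"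
  have T_monic: "T b g \<in> monics m" if "g \<in> monics m" for b g
  proof -
    let ?D = "smult ((b - 1) * poly g a0) L"
    have D: "degree ?D < m"
      by (rule degL)
    hence "degree (g + ?D) = m"
      using that by (subst degree_add_eq_left) (simp_all add: monics_def)
    moreover have "coeff ?D m = 0"
      using D by (rule coeff_eq_0)
    ultimately show ?thesis
      using that by (auto simp: T_def monics_def simp del: coeff_smult)
  qed
  have T_a0: "poly (T b g) a0 = b * poly g a0" for b g
    using L[OF a0] by (simp add: T_def algebra_simps)
  have T_other: "poly (T b g) a = poly g a" if "a \<in> A - {a0}" for b g a
    using L[of a] that by (simp add: T_def)
  have T_inv: "T b' (T b g) = g" if "b' * b = 1" for b b' g
  proof -
    have "T b' (T b g) = T b g + smult ((b' - 1) * poly (T b g) a0) L"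
      by (simp only: T_def)
    also have "\<dots> = g + smult ((b - 1) * poly g a0 + (b' - 1) * (b * poly g a0)) L"
      unfolding T_a0 by (simp add: T_def smult_add_left)
    also have "(b - 1) * poly g a0 + (b' - 1) * (b * poly g a0) = (b' * b - 1) * poly g a0"
      by (simp add: algebra_simps)
    finally show ?thesis
      using that by simp
  qed
  have "(\<Sum>g\<in>monics m. poly_character A g) = (\<Sum>g\<in>monics m. poly_character A (T c g))"
    by (rule sum.reindex_bij_witness[where j = "T (inverse c)" and i = "T c"])
       (use \<open>c \<noteq> 0\<close> in \<open>auto simp: T_monic T_inv\<close>)
  also have "\<dots> = (\<Sum>g\<in>monics m. - poly_character A g)"
  proof (intro sum.cong refl)
    fix g
    have split: "poly_character A h = quad_char (poly h a0) * (\<Prod>a\<in>A - {a0}. quad_char (poly h a))" for h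
      unfolding poly_character_def using a0 by (intro prod.remove) auto
    show "poly_character A (T c g) = - poly_character A g"
      using T_other by (simp add: split T_a0 quad_char_mult[OF odd_card] c)
  qed
  finally show ?thesis
    by (simp add: sum_negf)
qed

text \<open>
  The character sum is, up to sign, the first power sum of the L-function attached to \<open>A\<close>, whose
  degree is below \<open>card A\<close> and whose inverse roots have absolute value at most \<open>sqrt q\<close>.
\<close>

lemma Weil_bound_odd:
  fixes A :: "'a set"
  assumes d: "odd (card A)"
  shows "\<bar>\<Sum>x\<in>UNIV. \<Prod>a\<in>A. quad_char (x - a)\<bar> \<le> (real (card A) - 1) * sqrt (real CARD('a))"
proof -
  let ?\<psi> = "poly_character A"
  have "A \<noteq> {}"
    using d by auto
  have q: "CARD('a) > 1"
    by (rule card_field_gt_1)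
  have \<psi>_mult: "?\<psi> (g * h) = ?\<psi> g * ?\<psi> h" for g h
    by (simp add: poly_character_def quad_char_mult[OF odd_card] prod.distrib)
  have \<psi>_1: "?\<psi> 1 = 1"
    by (simp add: poly_character_def)
  define c where "c = (\<lambda>m. complex_of_real (\<Sum>g\<in>monics m. ?\<psi> g))"
  define S where "S = (\<lambda>k. complex_of_real (prime_power_sum ?\<psi> k))"
  have "norm (S 1) \<le> (real (card A) - 1) * sqrt (real CARD('a))"
  (* For k > card A we have q^k > k > card A, as required for the bound on the even power sums. *)
  proof (rule Riemann_hypothesis_from_power_sum_bound[where c = c and K = "card A + 1" and B = "4 * real (card A)"])
    show "c 0 = 1"
      by (simp add: c_def monics_0 \<psi>_1)
    show "c m = 0" if "m \<ge> card A" for m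
      using sum_monics_poly_character_eq_0[OF \<open>A \<noteq> {}\<close> that] by (simp only: c_def of_real_0)
    show "real CARD('a) > 0"
      using q by simp
    show "of_nat m * c m = (\<Sum>k=1..m. S k * c (m - k))" for m
    proof -
      have "complex_of_real (real m * (\<Sum>g\<in>monics m. ?\<psi> g)) = complex_of_real
          (\<Sum>k=1..m. prime_power_sum ?\<psi> k * (\<Sum>g\<in>monics (m - k). ?\<psi> g))"
        using Newton_identity_monics[of ?\<psi> m] \<psi>_mult \<psi>_1 by simp
      thus ?thesis
        by (simp add: c_def S_def)
    qed
    show "norm (S (2 * k)) \<le> 4 * real (card A) * real CARD('a) ^ k" if "k \<ge> card A + 1" for k
    proof -
      have "k < CARD('a) ^ k"
        using q by (intro power_gt_expt) simp
      with that have "CARD('a) ^ k > card A" "k > 0"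
        by linarith+
      with prime_power_sum_even_bound[OF d, of k] show ?thesis
        by (simp add: S_def)
    qed
  qed
  moreover have "norm (S 1) = \<bar>\<Sum>x\<in>UNIV. \<Prod>a\<in>A. quad_char (x - a)\<bar>"
  proof -
    have flip: "quad_char (a - x) = quad_char (- 1 :: 'a) * quad_char (x - a)" for a x :: 'a
      using quad_char_mult[OF odd_card, of "- 1" "x - a"] by simp
    have "?\<psi> [:- x, 1:] = quad_char (- 1 :: 'a) ^ card A * (\<Prod>a\<in>A. quad_char (x - a))" for x
    proof -
      have "?\<psi> [:- x, 1:] = (\<Prod>a\<in>A. quad_char (a - x))"
        by (simp add: poly_character_def)
      also have "\<dots> = (\<Prod>a\<in>A. quad_char (- 1 :: 'a) * quad_char (x - a))"
        by (intro prod.cong refl flip)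
      finally show ?thesis
        by (simp add: prod.distrib)
    qed
    hence "prime_power_sum ?\<psi> 1 =
        (\<Sum>x\<in>UNIV. quad_char (- 1 :: 'a) ^ card A * (\<Prod>a\<in>A. quad_char (x - a)))"
      by (simp only: prime_power_sum_1)
    hence "\<bar>prime_power_sum ?\<psi> 1\<bar> =
        \<bar>quad_char (- 1 :: 'a)\<bar> ^ card A * \<bar>\<Sum>x\<in>UNIV. \<Prod>a\<in>A. quad_char (x - a)\<bar>"
      by (simp add: abs_mult power_abs flip: sum_distrib_left)
    moreover have "\<bar>quad_char (- 1 :: 'a)\<bar> = 1"
      using quad_char_cases[of "- 1 :: 'a"] by auto
    ultimately show ?thesis
      by (simp add: S_def)
  qed
  ultimately show ?thesis
    by simp
qed

text \<open>
  The substitution \<open>x = a0 + 1 / u\<close> moves the point \<open>a0\<close> of \<open>A\<close> to infinity. For even \<open>card A\<close> the powers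
  of \<open>u\<close> that arise are squares, so the sum becomes one over \<open>u \<noteq> 0\<close> for a set with one element less,
  which is of odd size. The missing term at \<open>u = 0\<close> equals \<open>1\<close>.
\<close>

lemma Weil_bound_even:
  fixes A :: "'a set"
  assumes d: "even (card A)" and A: "A \<noteq> {}"
  shows "\<bar>\<Sum>x\<in>UNIV. \<Prod>a\<in>A. quad_char (x - a)\<bar> \<le> (real (card A) - 2) * sqrt (real CARD('a)) + 1"
proof -
  obtain a0 where a0: "a0 \<in> A"
    using A by blast
  define B where "B = A - {a0}"
  define C where "C = (\<lambda>b. 1 / (b - a0)) ` B"
  have inj: "inj_on (\<lambda>b. 1 / (b - a0)) B"
    by (auto simp: inj_on_def B_def)
  have card_B: "Suc (card B) = card A"
    unfolding B_def using a0 by (intro card.remove[symmetric]) auto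
  have card_C: "card C = card B"
    unfolding C_def using inj by (rule card_image)
  define \<kappa> where "\<kappa> = (\<Prod>b\<in>B. quad_char (a0 - b))"
  have \<kappa>: "\<bar>\<kappa>\<bar> = 1"
  proof -
    have "\<bar>quad_char (a0 - b)\<bar> = 1" if "b \<in> B" for b
      using that quad_char_cases[of "a0 - b"] by (auto simp: B_def)
    thus ?thesis
      by (simp add: \<kappa>_def abs_prod)
  qed
  let ?F = "\<lambda>u. \<kappa> * (\<Prod>c\<in>C. quad_char (u - c))"
  have F: "?F u = (\<Prod>b\<in>B. quad_char (1 + (a0 - b) * u))" for u
  proof -
    have "(\<Prod>c\<in>C. quad_char (u - c)) = (\<Prod>b\<in>B. quad_char (u - 1 / (b - a0)))"
      unfolding C_def using inj by (simp add: prod.reindex)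
    hence "?F u = (\<Prod>b\<in>B. quad_char ((a0 - b) * (u - 1 / (b - a0))))"
      by (simp add: \<kappa>_def quad_char_mult[OF odd_card] prod.distrib)
    also have "\<dots> = (\<Prod>b\<in>B. quad_char (1 + (a0 - b) * u))"
      by (intro prod.cong refl arg_cong[where f = quad_char]) (auto simp: B_def field_simps)
    finally show ?thesis .
  qed
  have shift: "(\<Prod>a\<in>A. quad_char (a0 + 1 / u - a)) = ?F u" if "u \<noteq> 0" for u
  proof -
    have sq: "quad_char (1 / u) ^ card A = 1"
    proof -
      obtain j where "card A = 2 * j"
        using d by (elim evenE)
      moreover have "quad_char (1 / u) ^ 2 = 1"
        using that quad_char_cases[of "1 / u"] by auto
      ultimately show ?thesis
        by (simp add: power_mult)
    qed
    have "(\<Prod>a\<in>A. quad_char (a0 + 1 / u - a)) = (\<Prod>a\<in>A. quad_char (1 / u) * quad_char (1 + (a0 - a) * u))"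
    proof (intro prod.cong refl)
      fix a
      have "a0 + 1 / u - a = 1 / u * (1 + (a0 - a) * u)"
        using that by (simp add: field_simps)
      thus "quad_char (a0 + 1 / u - a) = quad_char (1 / u) * quad_char (1 + (a0 - a) * u)"
        by (simp only: quad_char_mult[OF odd_card])
    qed
    also have "\<dots> = (\<Prod>a\<in>A. quad_char (1 + (a0 - a) * u))"
      by (simp add: prod.distrib sq)
    also have "\<dots> = (\<Prod>a\<in>B. quad_char (1 + (a0 - a) * u))"
      unfolding B_def using a0 by (subst prod.remove[of _ a0]) auto
    finally show ?thesis
      by (simp only: F)
  qed
  have "(\<Sum>x\<in>UNIV. \<Prod>a\<in>A. quad_char (x - a)) = (\<Sum>x\<in>UNIV - {a0}. \<Prod>a\<in>A. quad_char (x - a))"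
    using a0 by (intro sum.mono_neutral_right) (auto intro!: prod_zero)
  also have "\<dots> = (\<Sum>u\<in>UNIV - {0}. ?F u)"
    by (rule sum.reindex_bij_witness[where i = "\<lambda>u. a0 + 1 / u" and j = "\<lambda>x. 1 / (x - a0)"])
       (auto simp: shift[symmetric])
  also have "\<dots> = (\<Sum>u\<in>UNIV. ?F u) - ?F 0"
    by (simp add: sum_diff1)
  also have "?F 0 = 1"
    by (simp only: F) simp
  finally have "(\<Sum>x\<in>UNIV. \<Prod>a\<in>A. quad_char (x - a)) =
      \<kappa> * (\<Sum>u\<in>UNIV. \<Prod>c\<in>C. quad_char (u - c)) - 1"
    by (simp add: sum_distrib_left)
  hence "\<bar>\<Sum>x\<in>UNIV. \<Prod>a\<in>A. quad_char (x - a)\<bar> \<le>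
      \<bar>\<kappa> * (\<Sum>u\<in>UNIV. \<Prod>c\<in>C. quad_char (u - c))\<bar> + 1"
    by linarith
  also have "\<bar>\<kappa> * (\<Sum>u\<in>UNIV. \<Prod>c\<in>C. quad_char (u - c))\<bar> = \<bar>\<Sum>u\<in>UNIV. \<Prod>c\<in>C. quad_char (u - c)\<bar>"
    by (simp add: abs_mult \<kappa>)
  also have "\<dots> \<le> (real (card C) - 1) * sqrt (real CARD('a))"
    using d card_B card_C by (intro Weil_bound_odd) (metis even_Suc)
  also have "real (card C) - 1 = real (card A) - 2"
    using card_B card_C by linarith
  finally show ?thesis
    by simp
qed

end

section \<open>Counting leaves\<close>

text \<open>
  For the first sum, a subset is paired with its complement.
\<close>

lemma sum_Pow_card_and_sign:
  fixes A :: "'b set"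
  assumes "finite A" "A \<noteq> {}"
  shows "(\<Sum>T\<in>Pow A. real (card T)) = real (card A) * 2 ^ card A / 2"
    and "(\<Sum>T\<in>Pow A. (- 1 :: real) ^ card T) = 0"
proof -
  have "(\<Sum>T\<in>Pow A. real (card T)) = (\<Sum>T\<in>Pow A. real (card (A - T)))"
    by (rule sum.reindex_bij_witness[where i = "\<lambda>T. A - T" and j = "\<lambda>T. A - T"])
       (auto simp: double_diff)
  also have "\<dots> = (\<Sum>T\<in>Pow A. real (card A) - real (card T))"
    using assms(1) by (intro sum.cong refl) (auto simp: card_Diff_subset finite_subset card_mono of_nat_diff)
  also have "\<dots> = real (card A) * 2 ^ card A - (\<Sum>T\<in>Pow A. real (card T))"
    using assms(1) by (simp add: sum_subtractf card_Pow)
  finally show "(\<Sum>T\<in>Pow A. real (card T)) = real (card A) * 2 ^ card A / 2"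
    by simp
  have "(\<Prod>a\<in>A. (- 1 :: real) + 1) = (\<Sum>T\<in>Pow A. (\<Prod>a\<in>T. - 1) * (\<Prod>a\<in>A - T. 1))"
    using assms(1) by (rule prod_add)
  thus "(\<Sum>T\<in>Pow A. (- 1 :: real) ^ card T) = 0"
    using assms by (simp add: power_0_left card_gt_0_iff)
qed

lemma character_expansion:
  fixes A :: "'a::{field,finite} set"
  shows "(\<Sum>v\<in>UNIV. \<Prod>a\<in>A. 1 - quad_char (v - a)) =
           (\<Sum>T\<in>Pow A. (- 1) ^ card T * (\<Sum>v\<in>UNIV. \<Prod>a\<in>T. quad_char (v - a)))"
proof -
  have "(\<Prod>a\<in>A. 1 - quad_char (v - a)) = (\<Sum>T\<in>Pow A. (- 1) ^ card T * (\<Prod>a\<in>T. quad_char (v - a)))"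
    for v
  proof -
    have "(\<Prod>a\<in>A. 1 - quad_char (v - a)) = (\<Prod>a\<in>A. - 1 * quad_char (v - a) + 1)"
      by simp
    also have "\<dots> = (\<Sum>T\<in>Pow A. (\<Prod>a\<in>T. - 1 * quad_char (v - a)) * (\<Prod>a\<in>A - T. 1))"
      by (rule prod_add) simp
    also have "\<dots> = (\<Sum>T\<in>Pow A. (- 1) ^ card T * (\<Prod>a\<in>T. quad_char (v - a)))"
      unfolding prod.distrib by simp
    finally show ?thesis .
  qed
  thus ?thesis
    by (simp add: sum_distrib_left) (rule sum.swap)
qed

text \<open>
  A product with all factors nonzero and \<open>v\<close> outside \<open>A\<close> consists of factors \<open>2\<close> only. For \<open>v\<close> in \<open>A\<close> one
  factor is \<open>1\<close> and the others lie between \<open>0\<close> and \<open>2\<close>, whence the error term.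
\<close>

lemma character_product_sum_bounds:
  fixes A :: "'a::{field,finite} set"
  defines "L \<equiv> real (card {v. \<forall>a\<in>A. quad_char (v - a) = - 1})"
    and "M \<equiv> (\<Sum>v\<in>UNIV. \<Prod>a\<in>A. 1 - quad_char (v - a))"
  shows "2 ^ card A * L \<le> M" "M \<le> 2 ^ card A * L + real (card A) * 2 ^ card A / 2"
proof -
  let ?f = "\<lambda>v. \<Prod>a\<in>A. 1 - quad_char (v - a)"
  let ?N = "{v. \<forall>a\<in>A. quad_char (v - a) = - 1}"
  have N: "?f v = 2 ^ card A" if "v \<in> ?N" for v
    using that by simp
  have disj: "?N \<inter> A = {}"
    by force
  have "?f v = 0" if "v \<notin> ?N \<union> A" for v
  proof -
    from that obtain a where "a \<in> A" "quad_char (v - a) \<noteq> - 1"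
      by auto
    moreover have "v - a \<noteq> 0"
      using that \<open>a \<in> A\<close> by auto
    ultimately have "1 - quad_char (v - a) = 0"
      using quad_char_cases[of "v - a"] by auto
    thus ?thesis
      using \<open>a \<in> A\<close> by (intro prod_zero) auto
  qed
  hence "M = (\<Sum>v\<in>?N \<union> A. ?f v)"
    unfolding M_def by (intro sum.mono_neutral_right) auto
  also have "\<dots> = (\<Sum>v\<in>?N. ?f v) + (\<Sum>v\<in>A. ?f v)"
    using disj by (intro sum.union_disjoint) auto
  also have "(\<Sum>v\<in>?N. ?f v) = (\<Sum>v\<in>?N. 2 ^ card A)"
    by (intro sum.cong refl N)
  also have "\<dots> = 2 ^ card A * L"
    by (simp add: L_def)
  finally have M: "M = 2 ^ card A * L + (\<Sum>v\<in>A. ?f v)" .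
  have factor: "0 \<le> 1 - quad_char x" "1 - quad_char x \<le> 2" for x :: 'a
    using quad_char_cases[of x] by auto
  have "?f v \<ge> 0" for v
    using factor by (intro prod_nonneg) auto
  hence "(\<Sum>v\<in>A. ?f v) \<ge> 0"
    by (intro sum_nonneg) auto
  with M show "2 ^ card A * L \<le> M"
    by simp
  have "?f v \<le> 2 ^ card A / 2" if v: "v \<in> A" for v
  proof -
    have card_A: "card A = Suc (card (A - {v}))"
      using v by (intro card.remove) auto
    have "?f v = (1 - quad_char (v - v)) * (\<Prod>a\<in>A - {v}. 1 - quad_char (v - a))"
      using v by (intro prod.remove) auto
    also have "\<dots> = (\<Prod>a\<in>A - {v}. 1 - quad_char (v - a))"
      by simp
    also have "\<dots> \<le> (\<Prod>a\<in>A - {v}. 2)"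
      using factor by (intro prod_mono) auto
    also have "\<dots> = 2 ^ card (A - {v})"
      by simp
    also have "\<dots> = 2 ^ card A / 2"
      unfolding card_A by simp
    finally show ?thesis .
  qed
  hence "(\<Sum>v\<in>A. ?f v) \<le> (\<Sum>v\<in>A. 2 ^ card A / 2)"
    by (intro sum_mono)
  with M show "M \<le> 2 ^ card A * L + real (card A) * 2 ^ card A / 2"
    by simp
qed

text \<open>
  The left-hand side is the total error, multiplied by \<open>2 ^ n\<close>, when \<open>y = sqrt q\<close>: the first summand comes
  from the points of \<open>A\<close>, the rest from the bounds on character sums. The latter save a multiple of
  \<open>y * 2 ^ n\<close>, which outweighs the former as long as \<open>n < 2 y\<close>.
\<close>

lemma leaf_count_error_less:
  fixes y :: real
  assumes y: "y\<^sup>2 \<ge> 3" "y \<ge> 0" and n: "n \<ge> 1" "real n < 2 * y"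
  shows "real n * 2 ^ n / 2 + (y * (real n * 2 ^ n / 2 - 3 / 2 * 2 ^ n) + 2 ^ n / 2 - 1 + 2 * y) <
           2 ^ n * (real n * y / 2)"
proof -
  (* A rational number slightly below the square root of 3. *)
  have y17: "y \<ge> 17 / 10"
    by (rule power2_le_imp_le) (use y in \<open>simp_all add: power2_eq_square\<close>)
  have "(real n + 1) * 2 ^ n - 2 + 4 * y < 3 * y * 2 ^ n"
  proof -
    consider "n = 1" | "n = 2" | "n \<ge> 3"
      using n(1) by linarith
    thus ?thesis
    proof cases
      case 3
      have "(2 :: real) ^ 3 \<le> 2 ^ n"
        using 3 by (intro power_increasing) auto
      hence W: "(2 :: real) ^ n \<ge> 8"
        by simp
      define W :: real where "W = 2 ^ n"
      have "(y - 1) * (W - 4) \<ge> (7 / 10) * 4"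
        using W y17 by (intro mult_mono) (auto simp: W_def)
      moreover have "real n * W < (2 * y) * W"
        using n(2) by (intro mult_strict_right_mono) (auto simp: W_def)
      moreover have "(y - 1) * (W - 4) = y * W - W - 4 * y + 4" "(real n + 1) * W = real n * W + W"
        by (simp_all add: algebra_simps)
      ultimately have "(real n + 1) * W - 2 + 4 * y < 3 * y * W"
        by simp
      thus ?thesis
        by (simp only: W_def)
    qed (use y17 in auto)
  qed
  thus ?thesis
    by (simp add: algebra_simps)
qed

text \<open>
  If \<open>n \<ge> 2 sqrt q\<close>, the right-hand side is at least \<open>q\<close> and the bound is trivial. Otherwise the
  product over \<open>A\<close> of the factors \<open>1 - quad_char (v - a)\<close>, which is \<open>2 ^ n\<close> times the indicator function
  of the set except on \<open>A\<close>, is expanded into character sums over the subsets of \<open>A\<close>; the empty subset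
  contributes the main term \<open>q\<close>.
\<close>

lemma card_common_nonsquare_shifts_bound:
  fixes A :: "'a::{field,finite} set"
  assumes "prime p" "CARD('a) = p ^ e" "odd CARD('a)" and A: "A \<noteq> {}"
  defines "L \<equiv> real (card {v. \<forall>a\<in>A. quad_char (v - a) = - 1})"
  shows "\<bar>L - real CARD('a) / 2 ^ card A\<bar> < real (card A) * sqrt (real CARD('a)) / 2"
proof -
  define q where "q = real CARD('a)"
  define y where "y = sqrt q"
  define n where "n = card A"
  define W :: real where "W = 2 ^ n"
  have n: "n \<ge> 1"
    using A by (simp add: n_def Suc_le_eq card_gt_0_iff)
  have "CARD('a) \<ge> 3"
    using card_field_gt_1[where ?'a = 'a] assms(3) by (cases "CARD('a) = 2") auto
  hence q: "q \<ge> 3"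
    by (simp add: q_def)
  have y: "y\<^sup>2 = q" "y \<ge> 0"
    using q by (simp_all add: y_def)
  have W: "W \<ge> 2"
    using n self_le_power[of "2 :: real" n] by (simp add: W_def)
  show ?thesis
  proof (cases "real n < 2 * y")
    case False
    have "L \<le> q"
      unfolding L_def q_def by (simp add: card_mono)
    moreover have "L \<ge> 0"
      by (simp add: L_def)
    moreover have "q / W \<le> q / 2"
      using W q by (intro divide_left_mono) auto
    moreover have "q / W > 0"
      using W q by simp
    ultimately have "\<bar>L - q / W\<bar> < q"
      using q by linarith
    also have "q = y * y"
      using y by (simp add: power2_eq_square)
    also have "\<dots> \<le> real n / 2 * y"
      using False y by (intro mult_right_mono) auto
    finally show ?thesis
      by (simp add: q_def y_def n_def W_def)
  next
    case True
    define S where "S = (\<lambda>T. \<Sum>v\<in>(UNIV :: 'a set). \<Prod>a\<in>T. quad_char (v - a))"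
    (* The bounds for odd and for even sizes in one formula that is easy to sum over all subsets. *)
    define B where "B = (\<lambda>T :: 'a set. (real (card T) - 3 / 2) * y + 1 / 2 + (- 1) ^ card T * (1 / 2 - y / 2))"
    define M where "M = (\<Sum>v\<in>UNIV. \<Prod>a\<in>A. 1 - quad_char (v - a))"
    have S_bound: "\<bar>S T\<bar> \<le> B T" if "T \<noteq> {}" for T
    proof (cases "even (card T)")
      case True
      have "\<bar>S T\<bar> \<le> (real (card T) - 2) * y + 1"
        unfolding S_def y_def q_def using assms(1-3) True that by (rule Weil_bound_even)
      thus ?thesis
        using True by (simp add: B_def algebra_simps)
    next
      case False
      have "\<bar>S T\<bar> \<le> (real (card T) - 1) * y"
        unfolding S_def y_def q_def using assms(1-3) False by (rule Weil_bound_odd)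
      thus ?thesis
        using False by (simp add: B_def algebra_simps)
    qed
    have "M = (\<Sum>T\<in>Pow A. (- 1) ^ card T * S T)"
      unfolding M_def S_def by (rule character_expansion)
    also have "\<dots> = (- 1) ^ card ({} :: 'a set) * S {} + (\<Sum>T\<in>Pow A - {{}}. (- 1) ^ card T * S T)"
      by (intro sum.remove) auto
    also have "(- 1) ^ card ({} :: 'a set) * S {} = q"
      by (simp add: S_def q_def)
    finally have "\<bar>M - q\<bar> = \<bar>\<Sum>T\<in>Pow A - {{}}. (- 1) ^ card T * S T\<bar>"
      by simp
    also have "\<dots> \<le> (\<Sum>T\<in>Pow A - {{}}. \<bar>(- 1) ^ card T * S T\<bar>)"
      by (rule sum_abs)
    also have "\<dots> \<le> (\<Sum>T\<in>Pow A - {{}}. B T)"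
      using S_bound by (intro sum_mono) (auto simp: abs_mult power_abs)
    also have "\<dots> = (\<Sum>T\<in>Pow A. B T) - B {}"
      by (simp add: sum_diff1)
    also have "B {} = 1 - 2 * y"
      by (simp add: B_def)
    also have "(\<Sum>T\<in>Pow A. B T) =
        y * (\<Sum>T\<in>Pow A. real (card T)) + (1 / 2 - 3 / 2 * y) * real (card (Pow A)) +
        (1 / 2 - y / 2) * (\<Sum>T\<in>Pow A. (- 1) ^ card T)"
      by (simp add: B_def sum.distrib sum_distrib_left algebra_simps sum_subtractf)
    also have "\<dots> = y * (real n * W / 2) + (1 / 2 - 3 / 2 * y) * W"
      using sum_Pow_card_and_sign[of A] A by (simp add: card_Pow n_def W_def)
    finally have M: "\<bar>M - q\<bar> \<le> y * (real n * W / 2 - 3 / 2 * W) + W / 2 - 1 + 2 * y"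
      by (simp add: algebra_simps)
    have "W * L \<le> M" "M \<le> W * L + real n * W / 2"
      using character_product_sum_bounds[of A] by (simp_all add: W_def L_def M_def n_def)
    with M have "\<bar>W * L - q\<bar> \<le>
        real n * W / 2 + (y * (real n * W / 2 - 3 / 2 * W) + W / 2 - 1 + 2 * y)"
      by linarith
    also have "\<dots> < W * (real n * y / 2)"
      unfolding W_def using leaf_count_error_less[of y n] y q n True by simp
    finally have "\<bar>W * L - q\<bar> < W * (real n * y / 2)" .
    moreover have "W * L - q = W * (L - q / W)"
      using W by (simp add: field_simps)
    ultimately have "W * \<bar>L - q / W\<bar> < W * (real n * y / 2)"
      using W by (simp add: abs_mult)
    hence "\<bar>L - q / W\<bar> < real n * y / 2"
      using W by simp
    thus ?thesis
      by (simp add: q_def y_def n_def W_def)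
  qed
qed

lemma num_leaves_eq_card_nonsquare_shifts:
  fixes a :: "nat \<Rightarrow> 'a::{field,finite}"
  shows "num_leaves n a = card {v. \<forall>b\<in>a ` {1..n}. quad_char (v - b) = - 1}"
proof -
  let ?G = "with_proj (functional_graph n (\<lambda>i. monom 1 2 + [:a i:]))"
  have in_arcs: "in_arcs ?G v = {(u, w). w = v \<and> (\<exists>i\<in>{1..n}. u\<^sup>2 + a i = v)}" for v
    by (auto simp: in_arcs_def functional_graph_def poly_monom)
  have "in_degree ?G v = 0 \<longleftrightarrow> (\<forall>b\<in>a ` {1..n}. quad_char (v - b) = - 1)" for v
  proof -
    have fin: "finite (in_arcs ?G v)"
      by simp
    have "in_degree ?G v = 0 \<longleftrightarrow> in_arcs ?G v = {}"
      using fin unfolding in_degree_def by simp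
    also have "\<dots> \<longleftrightarrow> (\<forall>i\<in>{1..n}. \<forall>u. u\<^sup>2 + a i \<noteq> v)"
      unfolding in_arcs by auto
    also have "\<dots> \<longleftrightarrow> (\<forall>i\<in>{1..n}. \<forall>u. v - a i \<noteq> u\<^sup>2)"
      by (metis add_diff_cancel_right' diff_add_cancel)
    also have "\<dots> \<longleftrightarrow> (\<forall>i\<in>{1..n}. quad_char (v - a i) = - 1)"
    proof -
      have "(\<forall>u. x \<noteq> u\<^sup>2) \<longleftrightarrow> quad_char x = - 1" for x :: 'a
        by (auto simp: quad_char_def dest: spec[of _ 0])
      thus ?thesis
        by simp
    qed
    finally show ?thesis
      by simp
  qed
  thus ?thesis
    by (simp add: num_leaves_def leaves_def functional_graph_def)
qed

theorem theorem2p5: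
  fixes p k q n :: nat
    and a :: "nat \<Rightarrow> 'a::{field,finite}"
  assumes "prime p" and "odd p" and "k \<ge> 1" and "q = p ^ k"
    and "CARD('a) = q"
    and "n \<ge> 1"
    and "inj_on a {1..n}"
  shows "\<bar>real (num_leaves n a) - real q / 2 ^ n\<bar> < 2 / 3 * real n * sqrt (real q)
    \<and> (real n < 2 * sqrt (real q) \<longrightarrow>
        \<bar>real (num_leaves n a) - real q / 2 ^ n\<bar> < 1 / 2 * real n * sqrt (real q))"
proof -
  let ?A = "a ` {1..n}"
  have card_A: "card ?A = n"
    using assms(7) by (simp add: card_image)
  have "odd CARD('a)"
    using assms(2,4,5) by simp
  hence bound: "\<bar>real (num_leaves n a) - real q / 2 ^ n\<bar> < real n * sqrt (real q) / 2"
    using card_common_nonsquare_shifts_bound[of p k ?A] assms(1,4,5,6) card_A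
    by (auto simp: num_leaves_eq_card_nonsquare_shifts)
  define s where "s = real n * sqrt (real q)"
  have "s \<ge> 0" and "2 / 3 * real n * sqrt (real q) = 2 / 3 * s" "1 / 2 * real n * sqrt (real q) = s / 2"
    by (simp_all add: s_def)
  with bound show ?thesis
    unfolding s_def[symmetric] by auto
qed

end
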